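(* Let $g(\boldsymbol{w})=\frac m2\|\boldsymbol{w}\|^2$ with $m>0$, let $k\ge1$, and consider the $k$-th iteration of the Langevin Algorithm with Prior Diffusion (see context) with step sizes $\tilde\eta_{k-1},\eta_k>0$. Conditionally on $\tilde{\mathbf w}_{k-1}=\boldsymbol{w}_0$, there is a Markov process $\{\hat{\mathbf w}_t\}_{t\ge0}$ with $\hat{\mathbf w}_0=\boldsymbol{w}_0$ given by the SDE $$d\hat{\mathbf w}_t=-\left(m\hat{\mathbf w}_t+\frac{m\tilde\eta_{k-1}}{e^{m\eta_k}-1}\nabla f(\boldsymbol{w}_0)\right)dt+\sqrt2\,d\boldsymbol{B}_t,$$ such that, writing $p_{\boldsymbol{w}_0}(\boldsymbol{w},t|\boldsymbol{w}',t')$ for its transition density from $\boldsymbol{w}'$ at time $t'$ to $\boldsymbol{w}$ at time $t$, the variable $\hat{\mathbf w}_{\eta_k}\sim p_{\boldsymbol{w}_0}(\cdot,\eta_k|\boldsymbol{w}_0,0)$ has the same distribution as $\tilde{\mathbf w}_k$ (conditionally on $\tilde{\mathbf w}_{k-1}=\boldsymbol{w}_0$), and for all $\boldsymbol{w}\in\mathbb{R}^d$ $$p_{\boldsymbol{w}_0}(\boldsymbol{w},\eta_k|\boldsymbol{w}_0,0)=\left(\frac{2\pi(1-e^{-2m\eta_k})}{m}\right)^{-d/2}\exp\left[-\frac m2\cdot\frac{\left\|\boldsymbol{w}-\left(\boldsymbol{w}_0-\tilde\eta_{k-1}\nabla f(\boldsymbol{w}_0)\right)e^{-m\eta_k}\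right\|^2}{1-e^{-2m\eta_k}}\right].$$
   Context: $f:\mathbb{R}^d\to\mathbb{R}$ is twice differentiable, and $\boldsymbol{B}$ denotes a standard Brownian motion in $\mathbb{R}^d$. Langevin Algorithm with Prior Diffusion (LAPD) for $p_*\propto\exp(-f-g)$. Given an initial density $\tilde p_0$ and step sizes $\eta_k>0$, $\tilde\eta_{k-1}>0$, draw $\tilde{\mathbf w}_0\sim\tilde p_0$ and for $k=1,2,\dots$: Stage 1: $\mathbf w_k=\tilde{\mathbf w}_{k-1}-\tilde\eta_{k-1}\nabla f(\tilde{\mathbf w}_{k-1})$. Stage 2: $\tilde{\mathbf w}_k=\tilde{\mathbf w}(\eta_k)$, where $\tilde{\mathbf w}(\cdot)$ solves $d\tilde{\mathbf w}(s)=-\nabla g(\tilde{\mathbf w}(s))\,ds+\sqrt2\,d\boldsymbol{B}_s$, $\tilde{\mathbf w}(0)=\mathbf w_k$, with $\boldsymbol{B}$ a standard Brownian motion in $\mathbb{R}^d$ independent of the past. *)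

theory Defs
  imports "HOL-Probability.Probability"
begin

definition grad :: "('a::euclidean_space \<Rightarrow> real) \<Rightarrow> 'a \<Rightarrow> 'a" where
  "grad f x = (THE D. GDERIV f x :> D)"

definition twice_differentiable :: "('a::euclidean_space \<Rightarrow> real) \<Rightarrow> bool" where
  "twice_differentiable f \<longleftrightarrow>
     (\<forall>x. f differentiable (at x)) \<and> (\<forall>x. grad f differentiable (at x))"

text \<open>
  A process in continuous time is a family \<open>X :: real \<Rightarrow> 'w \<Rightarrow> 'a\<close> of which only the
  times \<open>t \<ge> 0\<close> are relevant. \<open>gen_by M T N X\<close> is the sigma-algebra on \<open>space M\<close> generated
  by the \<open>N\<close>-valued random variables \<open>X t\<close>, \<open>t \<in> T\<close>.
\<close>

definition gen_by :: "'w measure \<Rightarrow> 'i set \<Rightarrow> 'b measure \<Rightarrow> ('i \<Rightarrow> 'w \<Rightarrow> 'b) \<Rightarrow> 'w measure" where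
  "gen_by M T N X = vimage_algebra (space M) (\<lambda>\<omega>. \<lambda>t\<in>T. X t \<omega>) (PiM T (\<lambda>_. N))"

definition indep_algebras :: "'w measure \<Rightarrow> 'w measure \<Rightarrow> 'w measure \<Rightarrow> bool" where
  "indep_algebras M F G \<longleftrightarrow> prob_space.indep_set M (sets F) (sets G)"

text \<open>The density below says that \<open>B t - B s\<close> is Gaussian with mean \<open>0\<close> and covariance \<open>(t - s) I\<close>.\<close>

definition std_brownian_motion ::
    "'w measure \<Rightarrow> (real \<Rightarrow> 'w \<Rightarrow> 'a::euclidean_space) \<Rightarrow> bool" where
  "std_brownian_motion M B \<longleftrightarrow>
     prob_space M \<and>
     (\<forall>t\<ge>0. B t \<in> borel_measurable M) \<and>
     (AE \<omega> in M. B 0 \<omega> = 0) \<and>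
     (AE \<omega> in M. continuous_on {0..} (\<lambda>t. B t \<omega>)) \<and>
     (\<forall>s t. 0 \<le> s \<and> s < t \<longrightarrow>
        distributed M lborel (\<lambda>\<omega>. B t \<omega> - B s \<omega>)
          (\<lambda>x. ennreal (\<Prod>b\<in>Basis. normal_density 0 (sqrt (t - s)) (x \<bullet> b))) \<and>
        indep_algebras M (gen_by M {0..s} borel B)
          (vimage_algebra (space M) (\<lambda>\<omega>. B t \<omega> - B s \<omega>) borel))"

text \<open>
  \<open>sde_solution M B b \<sigma> \<xi> X\<close>: the process \<open>X\<close> solves \<open>dX = b(X) dt + \<sigma> dB\<close>, \<open>X 0 = \<xi>\<close>, with
  constant diffusion coefficient \<open>\<sigma>\<close>, so that the stochastic integral is \<open>\<sigma> B t\<close> and the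
  equation can be read pathwise. The independence clause says that \<open>B\<close> is a Brownian motion
  with respect to the filtration generated by \<open>(X, B)\<close> (nonanticipation); for \<open>s = 0\<close> it
  includes the independence of \<open>\<xi>\<close> and the driving noise.
\<close>

definition sde_solution ::
    "'w measure \<Rightarrow> (real \<Rightarrow> 'w \<Rightarrow> 'a::euclidean_space) \<Rightarrow> ('a \<Rightarrow> 'a) \<Rightarrow> real \<Rightarrow>
     ('w \<Rightarrow> 'a) \<Rightarrow> (real \<Rightarrow> 'w \<Rightarrow> 'a) \<Rightarrow> bool" where
  "sde_solution M B b \<sigma> \<xi> X \<longleftrightarrow>
     std_brownian_motion M B \<and>
     (\<forall>t\<ge>0. X t \<in> borel_measurable M) \<and>
     (\<forall>s t. 0 \<le> s \<and> s < t \<longrightarrow>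
        indep_algebras M (gen_by M {0..s} (borel \<Otimes>\<^sub>M borel) (\<lambda>u \<omega>. (X u \<omega>, B u \<omega>)))
          (vimage_algebra (space M) (\<lambda>\<omega>. B t \<omega> - B s \<omega>) borel)) \<and>
     (AE \<omega> in M. X 0 \<omega> = \<xi> \<omega> \<and> continuous_on {0..} (\<lambda>t. X t \<omega>) \<and>
        (\<forall>t\<ge>0. set_integrable lborel {0..t} (\<lambda>s. b (X s \<omega>)) \<and>
           X t \<omega> = \<xi> \<omega> + (LINT s:{0..t}|lborel. b (X s \<omega>)) + \<sigma> *\<^sub>R B t \<omega>))"

text \<open>
  \<open>K\<close> is a regular version of the conditional distribution of \<open>Y\<close> given \<open>X\<close>, that is,
  \<open>K x\<close> is the law of \<open>Y\<close> conditionally on \<open>X = x\<close>.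
\<close>

definition cond_distribution ::
    "'w measure \<Rightarrow> ('w \<Rightarrow> 'a::euclidean_space) \<Rightarrow> ('w \<Rightarrow> 'a) \<Rightarrow> ('a \<Rightarrow> 'a measure) \<Rightarrow> bool" where
  "cond_distribution M Y X K \<longleftrightarrow>
     X \<in> borel_measurable M \<and> Y \<in> borel_measurable M \<and>
     K \<in> borel \<rightarrow>\<^sub>M prob_algebra borel \<and>
     (\<forall>A\<in>sets borel. AE \<omega> in M.
        real_cond_exp M (vimage_algebra (space M) X borel) (\<lambda>\<omega>'. indicator A (Y \<omega>')) \<omega>
          = measure (K (X \<omega>)) A)"

definition markov_process ::
    "'w measure \<Rightarrow> (real \<Rightarrow> 'w \<Rightarrow> 'a::euclidean_space) \<Rightarrow> bool" where
  "markov_process M X \<longleftrightarrow>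
     (\<forall>t\<ge>0. X t \<in> borel_measurable M) \<and>
     (\<forall>s t. \<forall>A\<in>sets borel. 0 \<le> s \<and> s \<le> t \<longrightarrow>
        (AE \<omega> in M.
           real_cond_exp M (gen_by M {0..s} borel X) (\<lambda>\<omega>'. indicator A (X t \<omega>')) \<omega>
             = real_cond_exp M (vimage_algebra (space M) (X s) borel)
                 (\<lambda>\<omega>'. indicator A (X t \<omega>')) \<omega>))"

text \<open>\<open>p w t w' s\<close> is the transition density from \<open>w'\<close> at time \<open>s\<close> to \<open>w\<close> at time \<open>t\<close>.\<close>

definition transition_density ::
    "'w measure \<Rightarrow> (real \<Rightarrow> 'w \<Rightarrow> 'a::euclidean_space) \<Rightarrow>
     ('a \<Rightarrow> real \<Rightarrow> 'a \<Rightarrow> real \<Rightarrow> real) \<Rightarrow> bool" where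
  "transition_density M X p \<longleftrightarrow>
     (\<forall>s t. 0 \<le> s \<and> s < t \<longrightarrow>
        (\<lambda>(w, w'). p w t w' s) \<in> borel_measurable (borel \<Otimes>\<^sub>M borel) \<and>
        (\<forall>w w'. 0 \<le> p w t w' s) \<and>
        cond_distribution M (X t) (X s) (\<lambda>w'. density lborel (\<lambda>w. ennreal (p w t w' s))))"

text \<open>
  A run of the Langevin Algorithm with Prior Diffusion: \<open>wt k\<close> are the iterates
  (with a tilde on paper), \<open>ws k\<close> the results of Stage 1, \<open>V k\<close> the diffusion of Stage 2,
  \<open>B k\<close> its driving Brownian motion, \<open>\<eta>\<close> and \<open>\<eta>t\<close> the step sizes (\<open>\<eta>t\<close> with a tilde on paper),
  \<open>p0\<close> the initial density. The past before iteration \<open>k\<close> consists of the iterates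
  \<open>wt 0, ..., wt (k - 1)\<close> and of the processes \<open>V j\<close>, \<open>B j\<close> for \<open>1 \<le> j < k\<close>.
\<close>

definition lapd_past ::
    "'w measure \<Rightarrow> (nat \<Rightarrow> 'w \<Rightarrow> 'a::euclidean_space) \<Rightarrow> (nat \<Rightarrow> real \<Rightarrow> 'w \<Rightarrow> 'a) \<Rightarrow>
     (nat \<Rightarrow> real \<Rightarrow> 'w \<Rightarrow> 'a) \<Rightarrow> nat \<Rightarrow> 'w measure" where
  "lapd_past M wt V B k = vimage_algebra (space M)
     (\<lambda>\<omega>. (\<lambda>j\<in>{..<k}. wt j \<omega>, \<lambda>(j, t)\<in>{1..<k} \<times> {0..}. (V j t \<omega>, B j t \<omega>)))
     (PiM {..<k} (\<lambda>_. borel) \<Otimes>\<^sub>M PiM ({1..<k} \<times> {0..}) (\<lambda>_. borel \<Otimes>\<^sub>M borel))"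

definition lapd ::
    "'w measure \<Rightarrow> ('a::euclidean_space \<Rightarrow> real) \<Rightarrow> ('a \<Rightarrow> real) \<Rightarrow> ('a \<Rightarrow> real) \<Rightarrow>
     (nat \<Rightarrow> real) \<Rightarrow> (nat \<Rightarrow> real) \<Rightarrow> (nat \<Rightarrow> 'w \<Rightarrow> 'a) \<Rightarrow> (nat \<Rightarrow> 'w \<Rightarrow> 'a) \<Rightarrow>
     (nat \<Rightarrow> real \<Rightarrow> 'w \<Rightarrow> 'a) \<Rightarrow> (nat \<Rightarrow> real \<Rightarrow> 'w \<Rightarrow> 'a) \<Rightarrow> bool" where
  "lapd M f g p0 \<eta>t \<eta> wt ws V B \<longleftrightarrow>
     prob_space M \<and>
     (\<forall>x. 0 \<le> p0 x) \<and> distributed M lborel (wt 0) (\<lambda>x. ennreal (p0 x)) \<and>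
     (\<forall>k\<ge>1. 0 < \<eta>t (k - 1) \<and> 0 < \<eta> k \<and>
        (\<forall>\<omega>\<in>space M. ws k \<omega> = wt (k - 1) \<omega> - \<eta>t (k - 1) *\<^sub>R grad f (wt (k - 1) \<omega>)) \<and>
        sde_solution M (B k) (\<lambda>x. - grad g x) (sqrt 2) (ws k) (V k) \<and>
        indep_algebras M (lapd_past M wt V B k) (gen_by M {0..} borel (B k)) \<and>
        (\<forall>\<omega>\<in>space M. wt k \<omega> = V k (\<eta> k) \<omega>))"

end

theory Submission
  imports Defs
begin

text \<open>
  The driving noise is additive, so the linear equation \<open>dX = -(m X + v) dt + sqrt 2 dB\<close> can be solved
  path by path: with \<open>J t = exp (m t) B t - \<integral> m exp (m u) B u du\<close> (the Wiener integral of
  \<open>exp (m u)\<close>, integrated by parts) its only continuous solution started at \<open>\<xi>\<close> is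
  \<open>exp (- m t) (\<xi> + v / m) - v / m + sqrt 2 exp (- m t) J t\<close>.
  The increment \<open>J t - J s\<close> is an almost sure limit of Gaussian sums of Brownian increments after time
  \<open>s\<close>, hence independent of the past before \<open>s\<close> and Gaussian with covariance
  \<open>(exp (2 m t) - exp (2 m s)) / (2 m) I\<close>. This gives the Markov property and the transition density.
  Stage 2 solves the same equation with \<open>v = 0\<close> from the shifted initial value; the constant \<open>v\<close> of the
  statement is chosen such that both solutions have the same mean at time \<open>\<eta> k\<close>, and the noise term is
  the same.
\<close>

section \<open>Isotropic Gaussian measures\<close>

text \<open>The integrand \<open>exp (m u)\<close> is smooth and deterministic, so integration by
  parts gives a meaning to its integral against every continuous path; existence and uniqueness then
  reduce to a linear ODE with the path fixed. The delicate point is measurability: the filtrations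
  are not completed, while continuity and \<open>B 0 = 0\<close> hold only almost surely, so a
  formula valid off a null set does not yield adaptedness. The solution is therefore built from a
  path functional that is measurable everywhere with respect to the past, and the closed form is
  invoked only almost surely. Independence of the past and the Gaussian law are carried together in
  one product formula, \<open>indep_law\<close>, which survives sums and almost sure limits. For
  every \<open>w0\<close> the process is driven by the Brownian motion \<open>B k\<close> of Stage 2
  itself, so the two diffusions agree almost surely at time \<open>\<eta> k\<close>, which is more
  than equality in law.\<close>

definition iso_normal_density :: "'a::euclidean_space \<Rightarrow> real \<Rightarrow> 'a \<Rightarrow> real" where
  "iso_normal_density a \<sigma> x = (\<Prod>b\<in>Basis. normal_density (a \<bullet> b) \<sigma> (x \<bullet> b))"

text \<open>Scaling one fixed standard Gaussian covers \<open>v = 0\<close> (the point mass at the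
  origin) and reduces continuity in \<open>v\<close> to dominated convergence under a fixed
  measure.\<close>

definition iso_gauss :: "real \<Rightarrow> 'a::euclidean_space measure" where
  "iso_gauss v = distr (density lborel (iso_normal_density 0 1)) borel (\<lambda>x. sqrt v *\<^sub>R x)"

lemma iso_normal_density_nonneg [simp]: "0 \<le> iso_normal_density a \<sigma> x"
  by (simp add: iso_normal_density_def prod_nonneg)

lemma borel_measurable_iso_normal_density [measurable]:
  assumes [measurable]: "f \<in> borel_measurable M" "g \<in> borel_measurable M"
  shows "(\<lambda>x. iso_normal_density (f x) \<sigma> (g x)) \<in> borel_measurable M"
  unfolding iso_normal_density_def normal_density_def by measurable

lemma iso_normal_density_eq:
  fixes a :: "'a::euclidean_space"
  assumes "\<sigma> > 0"
  shows "iso_normal_density a \<sigma> x =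
    (2 * pi * \<sigma>\<^sup>2) powr (- real DIM('a) / 2) * exp (- (norm (x - a))\<^sup>2 / (2 * \<sigma>\<^sup>2))"
proof -
  have "iso_normal_density a \<sigma> x =
      (1 / sqrt (2 * pi * \<sigma>\<^sup>2)) ^ DIM('a) * (\<Prod>b\<in>Basis. exp (- (x \<bullet> b - a \<bullet> b)\<^sup>2 / (2 * \<sigma>\<^sup>2)))"
    by (simp only: iso_normal_density_def normal_density_def prod.distrib prod_constant)
  also have "(\<Prod>b\<in>Basis. exp (- (x \<bullet> b - a \<bullet> b)\<^sup>2 / (2 * \<sigma>\<^sup>2))) =
      exp (- (norm (x - a))\<^sup>2 / (2 * \<sigma>\<^sup>2))"
  proof -
    have "(norm (x - a))\<^sup>2 = (\<Sum>b\<in>Basis. (x \<bullet> b - a \<bullet> b)\<^sup>2)"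
      unfolding power2_norm_eq_inner
      by (subst euclidean_inner) (simp add: power2_eq_square inner_diff_left)
    then show ?thesis
      by (simp add: exp_sum[symmetric] sum_divide_distrib sum_negf)
  qed
  also have "(1 / sqrt (2 * pi * \<sigma>\<^sup>2)) ^ DIM('a) = (2 * pi * \<sigma>\<^sup>2) powr (- real DIM('a) / 2)"
  proof -
    have "(1 / sqrt (2 * pi * \<sigma>\<^sup>2)) = (2 * pi * \<sigma>\<^sup>2) powr (- 1 / 2)"
      using assms by (simp add: powr_minus_divide powr_half_sqrt)
    then have "(1 / sqrt (2 * pi * \<sigma>\<^sup>2)) ^ DIM('a) = ((2 * pi * \<sigma>\<^sup>2) powr (- 1 / 2)) powr real DIM('a)"
      using assms by (subst powr_realpow) auto
    then show ?thesis
      by (simp add: powr_powr)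
  qed
  finally show ?thesis .
qed

lemma nn_integral_lborel_affine:
  fixes a :: "'a::euclidean_space"
  assumes "c > 0" and [measurable]: "f \<in> borel_measurable borel"
  shows "(\<integral>\<^sup>+x. f x \<partial>lborel) = (\<integral>\<^sup>+x. ennreal (c ^ DIM('a)) * f (a + c *\<^sub>R x) \<partial>lborel)"
  using assms(1)
  by (subst lborel_affine[of c a]) (simp_all add: nn_integral_density nn_integral_distr)

lemma iso_normal_density_affine:
  fixes a :: "'a::euclidean_space"
  assumes "\<sigma> > 0"
  shows "\<sigma> ^ DIM('a) * iso_normal_density a \<sigma> (a + \<sigma> *\<^sub>R x) = iso_normal_density 0 1 x"
proof -
  have "\<sigma> * normal_density (a \<bullet> b) \<sigma> ((a + \<sigma> *\<^sub>R x) \<bullet> b) = normal_density (0 \<bullet> b) 1 (x \<bullet> b)" for b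
    using assms by (simp add: normal_density_def inner_add_left power_mult_distrib real_sqrt_mult)
  then show ?thesis
    by (simp add: iso_normal_density_def flip: prod.distrib prod_constant)
qed

lemma distr_affine_std_gauss:
  fixes a :: "'a::euclidean_space"
  assumes "\<sigma> > 0"
  shows "distr (density lborel (iso_normal_density 0 1)) borel (\<lambda>x. a + \<sigma> *\<^sub>R x) =
    density lborel (iso_normal_density a \<sigma>)"
proof (rule measure_eqI)
  fix A :: "'a set" assume "A \<in> sets (distr (density lborel (iso_normal_density 0 1)) borel (\<lambda>x. a + \<sigma> *\<^sub>R x))"
  then have [measurable]: "A \<in> sets borel" by simp
  have "emeasure (density lborel (iso_normal_density a \<sigma>)) A =
     (\<integral>\<^sup>+x. ennreal (iso_normal_density a \<sigma> x) * indicator A x \<partial>lborel)"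
    by (simp add: emeasure_density)
  also have "\<dots> = (\<integral>\<^sup>+x. ennreal (\<sigma> ^ DIM('a)) * (ennreal (iso_normal_density a \<sigma> (a + \<sigma> *\<^sub>R x)) * indicator A (a + \<sigma> *\<^sub>R x)) \<partial>lborel)"
    using assms by (subst nn_integral_lborel_affine[of \<sigma> _ a]) auto
  also have "\<dots> = (\<integral>\<^sup>+x. ennreal (iso_normal_density 0 1 x) * indicator A (a + \<sigma> *\<^sub>R x) \<partial>lborel)"
    using assms by (simp add: mult.assoc[symmetric] ennreal_mult'[symmetric] iso_normal_density_affine)
  also have "\<dots> = emeasure (distr (density lborel (iso_normal_density 0 1)) borel (\<lambda>x. a + \<sigma> *\<^sub>R x)) A"
    by (simp add: nn_integral_indicator[symmetric] nn_integral_distr nn_integral_density del: nn_integral_indicator)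
  finally show "emeasure (distr (density lborel (iso_normal_density 0 1)) borel (\<lambda>x. a + \<sigma> *\<^sub>R x)) A =
     emeasure (density lborel (iso_normal_density a \<sigma>)) A" ..
qed simp

lemma prob_space_std_gauss: "prob_space (density lborel (iso_normal_density 0 1))"
proof
  have "(\<integral>\<^sup>+x. ennreal (iso_normal_density 0 1 (x::'a)) \<partial>lborel) =
      (\<Prod>b\<in>(Basis::'a set). \<integral>\<^sup>+x. ennreal (normal_density (0 \<bullet> b) 1 x) \<partial>lborel)"
    unfolding iso_normal_density_def
    by (subst prod_ennreal[symmetric], simp) (subst nn_integral_lborel_prod, auto)
  also have "\<dots> = 1"
    using prob_space.emeasure_space_1[OF prob_space_normal_density[of 1 0]]
    by (simp add: emeasure_density)
  finally show "emeasure (density lborel (iso_normal_density 0 1)) (space (density lborel (iso_normal_density (0::'a) 1))) = 1"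
    by (simp add: emeasure_density)
qed

lemma prob_space_iso_gauss [simp]: "prob_space (iso_gauss v)"
  unfolding iso_gauss_def by (rule prob_space.prob_space_distr[OF prob_space_std_gauss]) simp

lemma finite_measure_iso_gauss [simp]: "finite_measure (iso_gauss v)"
  by (simp add: prob_space.finite_measure)

lemma sets_iso_gauss [simp, measurable_cong]: "sets (iso_gauss v) = sets borel"
  by (simp add: iso_gauss_def)

lemma space_iso_gauss [simp]: "space (iso_gauss v) = UNIV"
  by (simp add: iso_gauss_def)

lemma distr_affine_iso_gauss:
  fixes a :: "'a::euclidean_space"
  assumes "v > 0" "c > 0"
  shows "distr (iso_gauss v) borel (\<lambda>x. a + c *\<^sub>R x) = density lborel (iso_normal_density a (c * sqrt v))"
  using assms by (simp add: iso_gauss_def distr_distr comp_def distr_affine_std_gauss)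

lemma distr_scale_iso_gauss:
  assumes "c \<ge> 0"
  shows "distr (iso_gauss v) borel (\<lambda>x. c *\<^sub>R x) = iso_gauss (c\<^sup>2 * v)"
  using assms by (simp add: iso_gauss_def distr_distr comp_def real_sqrt_mult)

lemma iso_gauss_eq_density:
  assumes "v > 0"
  shows "iso_gauss v = density lborel (iso_normal_density 0 (sqrt v))"
  using distr_affine_std_gauss[of "sqrt v" 0] assms by (simp add: iso_gauss_def)

text \<open>Both densities factor over the coordinates, so the one-dimensional convolution formula
  applies in each of them.\<close>

lemma nn_integral_iso_normal_density_convolution:
  assumes "\<sigma> > 0" "\<tau> > 0"
  shows "(\<integral>\<^sup>+y. ennreal (iso_normal_density 0 \<sigma> (z - y) * iso_normal_density 0 \<tau> y) \<partial>lborel) =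
    iso_normal_density 0 (sqrt (\<sigma>\<^sup>2 + \<tau>\<^sup>2)) z"
proof -
  have "(\<integral>\<^sup>+y. ennreal (iso_normal_density 0 \<sigma> (z - y) * iso_normal_density 0 \<tau> y) \<partial>lborel) =
    (\<integral>\<^sup>+y. (\<Prod>b\<in>Basis. ennreal (normal_density 0 \<sigma> (z \<bullet> b - y \<bullet> b) * normal_density 0 \<tau> (y \<bullet> b))) \<partial>lborel)"
    by (simp add: iso_normal_density_def prod.distrib[symmetric] inner_diff_left prod_ennreal)
  also have "\<dots> = (\<Prod>b\<in>Basis. \<integral>\<^sup>+y. ennreal (normal_density 0 \<sigma> (z \<bullet> b - y) * normal_density 0 \<tau> y) \<partial>lborel)"
    by (subst nn_integral_lborel_prod) auto
  also have "\<dots> = (\<Prod>b\<in>Basis. ennreal (normal_density 0 (sqrt (\<sigma>\<^sup>2 + \<tau>\<^sup>2)) (z \<bullet> b)))"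
    using conv_normal_density_zero_mean[OF assms] by (intro prod.cong refl) (simp add: fun_eq_iff)
  finally show ?thesis
    by (simp add: iso_normal_density_def prod_ennreal)
qed

text \<open>Convolution written as an iterated integral, the shape that arises when two independent
  noises are frozen one after the other. Substituting \<open>z = y + x\<close> and exchanging the
  integrals exposes the convolution of the densities.\<close>

lemma nn_integral_iso_gauss_add:
  fixes h :: "'a::euclidean_space \<Rightarrow> ennreal"
  assumes "u > 0" "v > 0" and [measurable]: "h \<in> borel_measurable borel"
  shows "(\<integral>\<^sup>+y. \<integral>\<^sup>+x. h (y + x) \<partial>iso_gauss u \<partial>iso_gauss v) = (\<integral>\<^sup>+z. h z \<partial>iso_gauss (u + v))"
proof -
  let ?f = "\<lambda>x. ennreal (iso_normal_density 0 (sqrt u) (x::'a))"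
  let ?g = "\<lambda>x. ennreal (iso_normal_density 0 (sqrt v) (x::'a))"
  have "(\<integral>\<^sup>+y. \<integral>\<^sup>+x. h (y + x) \<partial>iso_gauss u \<partial>iso_gauss v) = (\<integral>\<^sup>+y. (\<integral>\<^sup>+x. ?f x * h (y + x) \<partial>lborel) * ?g y \<partial>lborel)"
    using assms by (simp add: iso_gauss_eq_density nn_integral_density mult.commute)
  also have "\<dots> = (\<integral>\<^sup>+y. (\<integral>\<^sup>+z. ?f (z - y) * h z \<partial>lborel) * ?g y \<partial>lborel)"
    using nn_integral_lborel_affine[of 1 "\<lambda>z. ?f (z - y) * h z" y for y] by simp
  also have "\<dots> = (\<integral>\<^sup>+y. \<integral>\<^sup>+z. h z * (?f (z - y) * ?g y) \<partial>lborel \<partial>lborel)"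
    by (simp add: nn_integral_cmult[symmetric] ac_simps)
  also have "\<dots> = (\<integral>\<^sup>+z. \<integral>\<^sup>+y. h z * (?f (z - y) * ?g y) \<partial>lborel \<partial>lborel)"
    by (rule lborel_pair.Fubini') measurable
  also have "\<dots> = (\<integral>\<^sup>+z. ennreal (iso_normal_density 0 (sqrt (u + v)) z) * h z \<partial>lborel)"
  proof -
    have "(\<integral>\<^sup>+y. ?f (z - y) * ?g y \<partial>lborel) = ennreal (iso_normal_density 0 (sqrt (u + v)) z)" for z
      using nn_integral_iso_normal_density_convolution[of "sqrt u" "sqrt v" z] assms
      by (simp add: ennreal_mult')
    then show ?thesis
      by (simp add: nn_integral_cmult) (simp only: mult.commute)
  qed
  also have "\<dots> = (\<integral>\<^sup>+z. h z \<partial>iso_gauss (u + v))"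
    using assms by (simp add: iso_gauss_eq_density nn_integral_density)
  finally show ?thesis .
qed

section \<open>Independence from a sub-sigma-algebra\<close>

text \<open>Taking \<open>G = space M\<close> recovers the law of \<open>W\<close>, so this single
  equation encodes both independence from \<open>F\<close> and the distribution
  \<open>\<nu>\<close>.\<close>

definition indep_law ::
    "'w measure \<Rightarrow> 'w measure \<Rightarrow> ('w \<Rightarrow> 'a::euclidean_space) \<Rightarrow> 'a measure \<Rightarrow> bool" where
  "indep_law M F W \<nu> \<longleftrightarrow> W \<in> borel_measurable M \<and>
     (\<forall>G\<in>sets F. \<forall>C\<in>sets borel. emeasure M (G \<inter> (W -` C \<inter> space M)) = emeasure M G * emeasure \<nu> C)"

lemma subalgebra_sets: "subalgebra M F \<Longrightarrow> G \<in> sets F \<Longrightarrow> G \<in> sets M"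
  by (auto simp: subalgebra_def)

lemma indep_law_distr:
  assumes "prob_space M" "subalgebra M F" "indep_law M F W \<nu>" "sets \<nu> = sets borel"
  shows "distr M borel W = \<nu>"
proof (rule measure_eqI)
  interpret prob_space M by fact
  have "space M \<in> sets F"
    using assms(2) by (metis sets.top subalgebra_def)
  then show "emeasure (distr M borel W) A = emeasure \<nu> A" if "A \<in> sets (distr M borel W)" for A
    using that assms(3)
    by (auto simp: indep_law_def emeasure_distr emeasure_space_1 dest!: bspec[of _ _ "space M"])
qed (simp add: assms)

text \<open>The freezing principle: the joint law of the identity into \<open>F\<close> and of
  \<open>W\<close> is a product measure, so Tonelli allows \<open>W\<close> to be integrated out
  with the \<open>F\<close>-measurable argument held fixed.\<close>

lemma indep_law_nn_integral:
  assumes "prob_space M" "subalgebra M F" "indep_law M F W \<nu>"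
    and [measurable_cong]: "sets \<nu> = sets borel" and k: "k \<in> borel_measurable (F \<Otimes>\<^sub>M borel)"
  shows "(\<integral>\<^sup>+\<omega>. k (\<omega>, W \<omega>) \<partial>M) = (\<integral>\<^sup>+\<omega>. \<integral>\<^sup>+y. k (\<omega>, y) \<partial>\<nu> \<partial>M)"
proof -
  interpret prob_space M by fact
  have W[measurable]: "W \<in> borel_measurable M"
    using assms(3) by (simp add: indep_law_def)
  have \<nu>: "prob_space \<nu>"
    using prob_space_distr[OF W] indep_law_distr[OF assms(1-4)] by simp
  let ?R = "restr_to_subalg M F"
  have id: "(\<lambda>\<omega>. \<omega>) \<in> M \<rightarrow>\<^sub>M F"
    using measurable_from_subalg[OF assms(2) measurable_ident] by (simp add: id_def)
  have pr[measurable]: "(\<lambda>\<omega>. (\<omega>, W \<omega>)) \<in> M \<rightarrow>\<^sub>M F \<Otimes>\<^sub>M borel"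
    using id by measurable
  have sets_eq: "sets (?R \<Otimes>\<^sub>M \<nu>) = sets (F \<Otimes>\<^sub>M borel)"
    by (intro sets_pair_measure_cong sets_restr_to_subalg assms)
  \<comment> \<open>The product formula of \<open>indep_law\<close> is exactly the agreement of both
    measures on rectangles.\<close>
  have eq: "?R \<Otimes>\<^sub>M \<nu> = distr M (F \<Otimes>\<^sub>M borel) (\<lambda>\<omega>. (\<omega>, W \<omega>))"
  proof (rule pair_measure_eqI)
    show "sigma_finite_measure ?R"
      using prob_space_restr_to_subalg[OF assms(2,1)] by (simp add: prob_space_imp_sigma_finite)
    show "sigma_finite_measure \<nu>"
      using \<nu> by (simp add: prob_space_imp_sigma_finite)
    show "sets (?R \<Otimes>\<^sub>M \<nu>) = sets (distr M (F \<Otimes>\<^sub>M borel) (\<lambda>\<omega>. (\<omega>, W \<omega>)))"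
      using sets_eq by simp
    fix A B assume "A \<in> sets ?R" "B \<in> sets \<nu>"
    then have A: "A \<in> sets F" and B: "B \<in> sets borel"
      using assms(2,4) by (simp_all add: sets_restr_to_subalg)
    have "A \<subseteq> space M"
      using subalgebra_sets[OF assms(2) A] by (rule sets.sets_into_space)
    then have "(\<lambda>\<omega>. (\<omega>, W \<omega>)) -` (A \<times> B) \<inter> space M = A \<inter> (W -` B \<inter> space M)"
      by auto
    then show "emeasure ?R A * emeasure \<nu> B = emeasure (distr M (F \<Otimes>\<^sub>M borel) (\<lambda>\<omega>. (\<omega>, W \<omega>))) (A \<times> B)"
      using A B assms(2,3) pr
      by (simp add: emeasure_distr emeasure_restr_to_subalg indep_law_def)
  qed
  interpret \<nu>: prob_space \<nu> by fact
  have k': "k \<in> borel_measurable (?R \<Otimes>\<^sub>M \<nu>)"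
    using k by (simp cong: measurable_cong_sets add: sets_eq)
  have "(\<integral>\<^sup>+\<omega>. k (\<omega>, W \<omega>) \<partial>M) = (\<integral>\<^sup>+z. k z \<partial>distr M (F \<Otimes>\<^sub>M borel) (\<lambda>\<omega>. (\<omega>, W \<omega>)))"
    using k by (simp add: nn_integral_distr)
  also have "\<dots> = (\<integral>\<^sup>+\<omega>. \<integral>\<^sup>+y. k (\<omega>, y) \<partial>\<nu> \<partial>?R)"
    using \<nu>.nn_integral_fst[OF k'] by (simp add: eq)
  \<comment> \<open>The inner integral is \<open>F\<close>-measurable, so its integrals under
    \<open>M\<close> and under the restriction of \<open>M\<close> to \<open>F\<close>
    coincide.\<close>
  also have "\<dots> = (\<integral>\<^sup>+\<omega>. \<integral>\<^sup>+y. k (\<omega>, y) \<partial>\<nu> \<partial>M)"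
  proof (rule nn_integral_subalgebra2[OF assms(2)])
    have "(\<lambda>\<omega>. \<integral>\<^sup>+y. k (\<omega>, y) \<partial>\<nu>) \<in> borel_measurable ?R"
      using \<nu>.borel_measurable_nn_integral_fst[OF k'] .
    then show "(\<lambda>\<omega>. \<integral>\<^sup>+y. k (\<omega>, y) \<partial>\<nu>) \<in> borel_measurable F"
      by (rule measurable_in_subalg'[OF assms(2)])
  qed
  finally show ?thesis .
qed

text \<open>Two algebras are needed because \<open>S\<close> is already known to \<open>F'\<close>
  while \<open>W\<close> is still independent of it: \<open>W\<close> is integrated out over
  \<open>F'\<close> first, then \<open>S\<close> over the smaller \<open>F\<close>.\<close>

lemma indep_law_add:
  fixes S W :: "'w \<Rightarrow> 'a::euclidean_space"
  assumes M: "prob_space M" and F: "subalgebra M F" and F': "subalgebra M F'" "sets F \<subseteq> sets F'"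
    and S: "indep_law M F S (iso_gauss u)" "S \<in> borel_measurable F'"
    and W: "indep_law M F' W (iso_gauss v)"
    and "u > 0" "v > 0"
  shows "indep_law M F (\<lambda>\<omega>. S \<omega> + W \<omega>) (iso_gauss (u + v))"
  unfolding indep_law_def
proof safe
  have [measurable]: "S \<in> borel_measurable M" "W \<in> borel_measurable M"
    using S W by (auto simp: indep_law_def)
  show "(\<lambda>\<omega>. S \<omega> + W \<omega>) \<in> borel_measurable M" by measurable
  note S(2)[measurable]
  fix G and C :: "'a set" assume GC[measurable]: "G \<in> sets F" "C \<in> sets borel"
  then have [measurable]: "G \<in> sets F'" "G \<in> sets M"
    using F' subalgebra_sets[of M F' G] by blast+
  interpret \<nu>: prob_space "iso_gauss v :: 'a measure" by simp
  define K where "K x = (\<integral>\<^sup>+y. indicator C (x + y) \<partial>iso_gauss v)" for x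
  have [measurable]: "K \<in> borel_measurable borel"
    unfolding K_def by measurable
  have "emeasure M (G \<inter> ((\<lambda>\<omega>. S \<omega> + W \<omega>) -` C \<inter> space M)) =
      (\<integral>\<^sup>+\<omega>. indicator (G \<inter> ((\<lambda>\<omega>. S \<omega> + W \<omega>) -` C \<inter> space M)) \<omega> \<partial>M)"
    by (subst nn_integral_indicator) auto
  also have "\<dots> = (\<integral>\<^sup>+\<omega>. indicator G \<omega> * indicator C (S \<omega> + W \<omega>) \<partial>M)"
    by (intro nn_integral_cong) (auto split: split_indicator)
  also have "\<dots> = (\<integral>\<^sup>+\<omega>. \<integral>\<^sup>+y. indicator G \<omega> * indicator C (S \<omega> + y) \<partial>iso_gauss v \<partial>M)"
    using indep_law_nn_integral[OF M F'(1) W, of "\<lambda>(\<omega>, y). indicator G \<omega> * indicator C (S \<omega> + y)"]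
    by simp
  also have "\<dots> = (\<integral>\<^sup>+\<omega>. indicator G \<omega> * K (S \<omega>) \<partial>M)"
    by (simp add: nn_integral_cmult K_def)
  also have "\<dots> = (\<integral>\<^sup>+\<omega>. \<integral>\<^sup>+x. indicator G \<omega> * K x \<partial>iso_gauss u \<partial>M)"
    using indep_law_nn_integral[OF M F S(1), of "\<lambda>(\<omega>, x). indicator G \<omega> * K x"] by simp
  also have "\<dots> = emeasure M G * (\<integral>\<^sup>+x. \<integral>\<^sup>+y. indicator C (x + y) \<partial>iso_gauss v \<partial>iso_gauss u)"
    by (simp add: nn_integral_cmult nn_integral_multc K_def[symmetric])
  also have "\<dots> = emeasure M G * emeasure (iso_gauss (u + v)) C"
    using \<open>u > 0\<close> \<open>v > 0\<close> by (simp add: nn_integral_iso_gauss_add add.commute)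
  finally show "emeasure M (G \<inter> ((\<lambda>\<omega>. S \<omega> + W \<omega>) -` C \<inter> space M)) = emeasure M G * emeasure (iso_gauss (u + v)) C" .
qed

lemma indep_law_scale:
  fixes W :: "'w \<Rightarrow> 'a::euclidean_space"
  assumes "indep_law M F W (iso_gauss v)" "c \<ge> 0"
  shows "indep_law M F (\<lambda>\<omega>. c *\<^sub>R W \<omega>) (iso_gauss (c\<^sup>2 * v))"
  unfolding indep_law_def
proof safe
  have [measurable]: "W \<in> borel_measurable M"
    using assms by (auto simp: indep_law_def)
  show "(\<lambda>\<omega>. c *\<^sub>R W \<omega>) \<in> borel_measurable M" by measurable
  fix G and C :: "'a set" assume GC[measurable]: "G \<in> sets F" "C \<in> sets borel"
  have C: "(\<lambda>x. c *\<^sub>R x) -` C \<in> sets borel"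
    using measurable_sets[of "\<lambda>x. c *\<^sub>R x" borel borel C] by simp
  have "(\<lambda>\<omega>. c *\<^sub>R W \<omega>) -` C = W -` ((\<lambda>x. c *\<^sub>R x) -` C)"
    by auto
  then have "emeasure M (G \<inter> ((\<lambda>\<omega>. c *\<^sub>R W \<omega>) -` C \<inter> space M)) = emeasure M G * emeasure (iso_gauss v) ((\<lambda>x. c *\<^sub>R x) -` C)"
    using assms(1) GC C by (simp add: indep_law_def)
  also have "emeasure (iso_gauss v) ((\<lambda>x. c *\<^sub>R x) -` C) = emeasure (iso_gauss (c\<^sup>2 * v)) C"
    by (subst distr_scale_iso_gauss[OF assms(2), symmetric]) (simp add: emeasure_distr)
  finally show "emeasure M (G \<inter> ((\<lambda>\<omega>. c *\<^sub>R W \<omega>) -` C \<inter> space M)) = emeasure M G * emeasure (iso_gauss (c\<^sup>2 * v)) C" .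
qed

lemma indep_law_mono:
  "indep_law M F W \<nu> \<Longrightarrow> sets F' \<subseteq> sets F \<Longrightarrow> indep_law M F' W \<nu>"
  by (auto simp: indep_law_def)

text \<open>Outside a closed set the distance is positive, so the truncated expression vanishes for
  large \<open>j\<close>. Nonemptiness matters since \<open>infdist\<close> to the empty set is 0 by
  convention.\<close>

lemma LIMSEQ_infdist_indicator:
  fixes C :: "'a::metric_space set"
  assumes "closed C" "C \<noteq> {}"
  shows "(\<lambda>j. max 0 (1 - real j * infdist x C)) \<longlonglongrightarrow> indicator C x"
proof (cases "x \<in> C")
  case True
  then show ?thesis by simp
next
  case False
  then have pos: "infdist x C > 0"
    using assms by (simp add: infdist_pos_not_in_closed)
  then obtain N :: nat where N: "1 < real N * infdist x C"
    using reals_Archimedean3 by blast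
  have "max 0 (1 - real j * infdist x C) = 0" if "j \<ge> N" for j
  proof -
    have "real N * infdist x C \<le> real j * infdist x C"
      using that pos by (intro mult_right_mono) auto
    then show ?thesis using N by simp
  qed
  then have "\<forall>\<^sub>F j in sequentially. max 0 (1 - real j * infdist x C) = 0"
    using eventually_sequentially by blast
  then show ?thesis
    using False by (simp add: tendsto_eventually)
qed

text \<open>Closed sets determine a finite Borel measure, and their indicators are limits of bounded continuous functions.\<close>

lemma indep_law_LIMSEQ:
  fixes W :: "'w \<Rightarrow> 'a::euclidean_space"
  assumes M: "prob_space M" and F: "subalgebra M F"
    and n: "\<And>n. indep_law M F (Wn n) (iso_gauss (vn n))"
    and W[measurable]: "W \<in> borel_measurable M"
    and lim: "AE \<omega> in M. (\<lambda>n. Wn n \<omega>) \<longlonglongrightarrow> W \<omega>" and v: "vn \<longlonglongrightarrow> v"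
  shows "indep_law M F W (iso_gauss v)"
  unfolding indep_law_def
proof safe
  interpret prob_space M by fact
  interpret \<gamma>: prob_space "iso_gauss v" by simp
  interpret \<gamma>1: prob_space "density lborel (iso_normal_density (0::'a) 1)" by (rule prob_space_std_gauss)
  have Wn[measurable]: "Wn n \<in> borel_measurable M" for n
    using n by (auto simp: indep_law_def)
  show "W \<in> borel_measurable M" by fact
  fix G and C :: "'a set" assume GC[measurable]: "G \<in> sets F" "C \<in> sets borel"
  then have GM[measurable]: "G \<in> sets M"
    using F subalgebra_sets[of M F G] by blast
  \<comment> \<open>The product formula is first passed to the limit for continuous test functions
    with values in the unit interval, where almost sure convergence of \<open>Wn\<close>
    suffices.\<close>
  have cont: "(\<integral>\<omega>. indicator G \<omega> * h (W \<omega>) \<partial>M) = measure M G * (\<integral>x. h x \<partial>iso_gauss v)"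
    if h: "continuous_on UNIV h" "\<And>x. 0 \<le> h x" "\<And>x. h x \<le> 1" for h :: "'a \<Rightarrow> real"
  proof (rule LIMSEQ_unique)
    have [measurable]: "h \<in> borel_measurable borel"
      using h(1) by (rule borel_measurable_continuous_onI)
    have eq: "(\<integral>\<omega>. indicator G \<omega> * h (Wn k \<omega>) \<partial>M) = measure M G * (\<integral>x. h x \<partial>iso_gauss (vn k))" for k
    proof -
      interpret \<gamma>k: prob_space "iso_gauss (vn k)" by simp
      have "(\<integral>\<^sup>+\<omega>. ennreal (indicator G \<omega> * h (Wn k \<omega>)) \<partial>M) =
        (\<integral>\<^sup>+\<omega>. \<integral>\<^sup>+x. ennreal (indicator G \<omega> * h x) \<partial>iso_gauss (vn k) \<partial>M)"
        using indep_law_nn_integral[OF M F n, where k="\<lambda>(\<omega>, x). ennreal (indicator G \<omega> * h x)"] by simp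
      also have "\<dots> = emeasure M G * (\<integral>\<^sup>+x. ennreal (h x) \<partial>iso_gauss (vn k))"
        by (simp add: ennreal_mult'' h nn_integral_cmult nn_integral_multc ennreal_indicator)
      also have "(\<integral>\<^sup>+x. ennreal (h x) \<partial>iso_gauss (vn k)) = ennreal (\<integral>x. h x \<partial>iso_gauss (vn k))"
        using h by (intro nn_integral_eq_integral \<gamma>k.integrable_const_bound[where B=1]) auto
      finally have "(\<integral>\<^sup>+\<omega>. ennreal (indicator G \<omega> * h (Wn k \<omega>)) \<partial>M) =
        ennreal (measure M G * (\<integral>x. h x \<partial>iso_gauss (vn k)))"
        by (simp add: emeasure_eq_measure ennreal_mult')
      then show ?thesis
        using h by (intro integral_eq_nn_integral[THEN trans]) (auto simp: enn2real_ennreal)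
    qed
    show "(\<lambda>k. \<integral>\<omega>. indicator G \<omega> * h (Wn k \<omega>) \<partial>M) \<longlonglongrightarrow> (\<integral>\<omega>. indicator G \<omega> * h (W \<omega>) \<partial>M)"
    proof (rule integral_dominated_convergence[where w="\<lambda>_. 1"])
      show "AE \<omega> in M. (\<lambda>k. indicator G \<omega> * h (Wn k \<omega>)) \<longlonglongrightarrow> indicator G \<omega> * h (W \<omega>)"
        using lim by eventually_elim
          (intro tendsto_mult tendsto_const continuous_on_tendsto_compose[OF h(1)], auto)
    qed (use h in \<open>auto split: split_indicator\<close>)
    \<comment> \<open>This moves the variance from the measure into the integrand, where dominated
      convergence can act on it.\<close>
    have int: "(\<integral>x. h x \<partial>iso_gauss u) = (\<integral>x. h (sqrt u *\<^sub>R x) \<partial>density lborel (iso_normal_density 0 1))" for u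
      by (simp add: iso_gauss_def integral_distr)
    have "(\<lambda>k. \<integral>x. h x \<partial>iso_gauss (vn k)) \<longlonglongrightarrow> (\<integral>x. h x \<partial>iso_gauss v)"
      unfolding int
    proof (rule integral_dominated_convergence[where w="\<lambda>_. 1"])
      show "AE x in density lborel (iso_normal_density 0 1). (\<lambda>k. h (sqrt (vn k) *\<^sub>R x)) \<longlonglongrightarrow> h (sqrt v *\<^sub>R x)"
        by (intro AE_I2 continuous_on_tendsto_compose[OF h(1)]) (auto intro!: tendsto_intros v)
    qed (use h in auto)
    then show "(\<lambda>k. \<integral>\<omega>. indicator G \<omega> * h (Wn k \<omega>) \<partial>M) \<longlonglongrightarrow> measure M G * (\<integral>x. h x \<partial>iso_gauss v)"
      unfolding eq by (intro tendsto_intros)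
  qed
  have closed: "measure M (G \<inter> (W -` D \<inter> space M)) = measure M G * measure (iso_gauss v) D"
    if D: "closed D" for D
  proof (cases "D = {}")
    case False
    have [measurable]: "D \<in> sets borel" using D by simp
    define h where "h j x = max 0 (1 - real j * infdist x D)" for j x
    have h: "continuous_on UNIV (h j)" "0 \<le> h j x" "h j x \<le> 1" for j x
      by (auto simp: h_def infdist_nonneg intro!: continuous_intros mult_nonneg_nonneg)
    have [measurable]: "h j \<in> borel_measurable borel" for j
      using h(1) by (rule borel_measurable_continuous_onI)
    note hlim = LIMSEQ_infdist_indicator[OF D False, folded h_def]
    have "(\<lambda>j. \<integral>\<omega>. indicator G \<omega> * h j (W \<omega>) \<partial>M) \<longlonglongrightarrow> (\<integral>\<omega>. indicator G \<omega> * indicator D (W \<omega>) \<partial>M)"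
    proof (rule integral_dominated_convergence[where w="\<lambda>_. 1"])
      show "AE \<omega> in M. (\<lambda>j. indicator G \<omega> * h j (W \<omega>)) \<longlonglongrightarrow> indicator G \<omega> * indicator D (W \<omega>)"
        by (intro AE_I2 tendsto_mult tendsto_const hlim)
    qed (use h in \<open>auto split: split_indicator\<close>)
    moreover have "(\<lambda>j. \<integral>x. h j x \<partial>iso_gauss v) \<longlonglongrightarrow> (\<integral>x. indicator D x \<partial>iso_gauss v)"
      by (rule integral_dominated_convergence[where w="\<lambda>_. 1"])
        (use h hlim in \<open>auto intro!: tendsto_intros split: split_indicator\<close>)
    then have "(\<lambda>j. \<integral>\<omega>. indicator G \<omega> * h j (W \<omega>) \<partial>M) \<longlonglongrightarrow> measure M G * measure (iso_gauss v) D"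
      unfolding cont[OF h] by (auto intro!: tendsto_intros)
    ultimately have "(\<integral>\<omega>. indicator G \<omega> * indicator D (W \<omega>) \<partial>M) = measure M G * measure (iso_gauss v) D"
      by (rule LIMSEQ_unique)
    moreover have "(\<integral>\<omega>. indicat_real G \<omega> * indicator D (W \<omega>) \<partial>M) =
        (\<integral>\<omega>. indicat_real (G \<inter> (W -` D \<inter> space M)) \<omega> \<partial>M)"
      by (intro Bochner_Integration.integral_cong) (auto split: split_indicator)
    ultimately show ?thesis
      using GM by simp
  qed simp
  \<comment> \<open>With \<open>G\<close> fixed, both sides of the product formula are finite Borel
    measures in the remaining set, so a pi-system of closed sets decides their equality.\<close>
  define \<rho>1 where "\<rho>1 = distr (density M (indicator G)) borel W"
  define \<rho>2 :: "'a measure" where "\<rho>2 = density (iso_gauss v) (\<lambda>_. emeasure M G)"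
  have \<rho>1: "emeasure \<rho>1 D = emeasure M (G \<inter> (W -` D \<inter> space M))" if [measurable]: "D \<in> sets borel" for D
    by (simp add: \<rho>1_def emeasure_distr emeasure_restricted)
  have \<rho>2: "emeasure \<rho>2 D = emeasure M G * emeasure (iso_gauss v) D" if [measurable]: "D \<in> sets borel" for D
    by (simp add: \<rho>2_def emeasure_density nn_integral_cmult)
  have "\<rho>1 = \<rho>2"
  proof (rule measure_eqI_generator_eq[where E="Collect closed" and \<Omega>=UNIV and A="\<lambda>_. UNIV"])
    show "Int_stable (Collect closed :: 'a set set)"
      by (auto simp: Int_stable_def)
    show "emeasure \<rho>1 X = emeasure \<rho>2 X" if "X \<in> Collect closed" for X
      using closed[of X] that
      by (simp add: \<rho>1 \<rho>2 emeasure_eq_measure \<gamma>.emeasure_eq_measure ennreal_mult'')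
    show "sets \<rho>1 = sigma_sets UNIV (Collect closed)" "sets \<rho>2 = sigma_sets UNIV (Collect closed)"
      by (simp_all add: \<rho>1_def \<rho>2_def borel_eq_closed)
    show "emeasure \<rho>1 UNIV \<noteq> \<infinity>"
      by (simp add: \<rho>1 emeasure_eq_measure)
  qed auto
  then show "emeasure M (G \<inter> (W -` C \<inter> space M)) = emeasure M G * emeasure (iso_gauss v) C"
    using \<rho>1 \<rho>2 GC by metis
qed

section \<open>Wiener integral of an exponential\<close>

lemma space_gen_by [simp]: "space (gen_by M T N X) = space M"
  by (simp add: gen_by_def)

lemma measurable_gen_by:
  assumes "t \<in> T" "space N = UNIV"
  shows "X t \<in> gen_by M T N X \<rightarrow>\<^sub>M N"
proof -
  have "(\<lambda>\<omega>. \<lambda>t\<in>T. X t \<omega>) \<in> gen_by M T N X \<rightarrow>\<^sub>M PiM T (\<lambda>_. N)"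
    unfolding gen_by_def using assms by (intro measurable_vimage_algebra1) (auto simp: space_PiM)
  from measurable_compose[OF this measurable_component_singleton[OF assms(1)]]
  show ?thesis using assms(1) by simp
qed

lemma sets_gen_by_subset:
  assumes "space F = space M" "\<And>t. t \<in> T \<Longrightarrow> X t \<in> F \<rightarrow>\<^sub>M N"
  shows "sets (gen_by M T N X) \<subseteq> sets F"
  unfolding gen_by_def
  using assms by (intro sets_image_in_sets measurable_restrict) auto

lemma subalgebra_gen_by:
  assumes "\<And>t. t \<in> T \<Longrightarrow> X t \<in> M \<rightarrow>\<^sub>M N"
  shows "subalgebra M (gen_by M T N X)"
  using sets_gen_by_subset[of M M T X N] assms by (auto simp: subalgebra_def)

lemma subalgebra_vimage_algebra:
  "W \<in> borel_measurable M \<Longrightarrow> subalgebra M (vimage_algebra (space M) W borel)"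
  using sets_image_in_sets[of M "space M" W borel] by (auto simp: subalgebra_def)

lemma indep_algebras_imp_indep_law:
  fixes W :: "'w \<Rightarrow> 'a::euclidean_space"
  assumes "prob_space M" "W \<in> borel_measurable M"
    "indep_algebras M F (vimage_algebra (space M) W borel)"
  shows "indep_law M F W (distr M borel W)"
  unfolding indep_law_def
proof safe
  interpret prob_space M by fact
  fix G and C :: "'a set" assume "G \<in> sets F" and C: "C \<in> sets borel"
  moreover have "W -` C \<inter> space M \<in> sets (vimage_algebra (space M) W borel)"
    using C by (rule in_vimage_algebra)
  ultimately have "prob (G \<inter> (W -` C \<inter> space M)) = prob G * prob (W -` C \<inter> space M)"
    using assms(3) unfolding indep_algebras_def by (intro indep_setD)
  then show "emeasure M (G \<inter> (W -` C \<inter> space M)) = emeasure M G * emeasure (distr M borel W) C"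
    using assms(2) C by (simp add: emeasure_distr emeasure_eq_measure ennreal_mult'')
qed fact

text \<open>The product density in the definition of Brownian motion is the one of
  \<open>iso_gauss (t - s)\<close>, so law and independence merge into
  \<open>indep_law\<close>.\<close>

lemma brownian_increment_indep_law:
  assumes B: "std_brownian_motion M B" and "0 \<le> s" "s < t"
  shows "indep_law M (gen_by M {0..s} borel B) (\<lambda>\<omega>. B t \<omega> - B s \<omega>) (iso_gauss (t - s))"
proof -
  have [measurable]: "B t \<in> borel_measurable M" "B s \<in> borel_measurable M"
    using assms by (auto simp: std_brownian_motion_def)
  have D: "distributed M lborel (\<lambda>\<omega>. B t \<omega> - B s \<omega>)
          (\<lambda>x. ennreal (\<Prod>b\<in>Basis. normal_density 0 (sqrt (t - s)) (x \<bullet> b)))"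
    and I: "indep_algebras M (gen_by M {0..s} borel B)
          (vimage_algebra (space M) (\<lambda>\<omega>. B t \<omega> - B s \<omega>) borel)" and "prob_space M"
    using assms unfolding std_brownian_motion_def by blast+
  have "distr M borel (\<lambda>\<omega>. B t \<omega> - B s \<omega>) = distr M lborel (\<lambda>\<omega>. B t \<omega> - B s \<omega>)"
    by (rule distr_cong) auto
  also have "\<dots> = iso_gauss (t - s)"
    using D \<open>s < t\<close> by (simp add: distributed_def iso_gauss_eq_density iso_normal_density_def)
  finally show ?thesis
    using indep_algebras_imp_indep_law[OF \<open>prob_space M\<close> _ I] by simp
qed

text \<open>Induction along the grid: the partial sum is measurable at time
  \<open>\<tau> (Suc j)\<close>, and the next increment is independent of everything up to that
  time. The sum has \<open>Suc j\<close> terms because an empty one would have variance 0, outside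
  the scope of \<open>indep_law_add\<close>.\<close>

lemma brownian_sum_indep_law:
  fixes B :: "real \<Rightarrow> 'w \<Rightarrow> 'a::euclidean_space"
  assumes B: "std_brownian_motion M B" and "0 \<le> \<tau> 0" "strict_mono \<tau>" and a: "\<And>i. a i > 0"
  shows "indep_law M (gen_by M {0..\<tau> 0} borel B)
      (\<lambda>\<omega>. \<Sum>i<Suc j. a i *\<^sub>R (B (\<tau> (Suc i)) \<omega> - B (\<tau> i) \<omega>))
      (iso_gauss (\<Sum>i<Suc j. (a i)\<^sup>2 * (\<tau> (Suc i) - \<tau> i)))"
proof -
  have M: "prob_space M" and Bm: "B u \<in> borel_measurable M" if "u \<ge> 0" for u
    using B that by (auto simp: std_brownian_motion_def)
  have \<tau>: "0 \<le> \<tau> i" "\<tau> i < \<tau> (Suc i)" for i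
    using assms(2) strict_mono_less_eq[OF assms(3), of 0 i] strict_mono_less[OF assms(3)] by auto
  have step: "indep_law M (gen_by M {0..\<tau> i} borel B) (\<lambda>\<omega>. a i *\<^sub>R (B (\<tau> (Suc i)) \<omega> - B (\<tau> i) \<omega>))
      (iso_gauss ((a i)\<^sup>2 * (\<tau> (Suc i) - \<tau> i)))" for i
    using a[of i] \<tau>[of i] by (intro indep_law_scale brownian_increment_indep_law[OF B]) auto
  have sub: "subalgebra M (gen_by M {0..u} borel B)" for u
    using Bm by (intro subalgebra_gen_by) auto
  show ?thesis
  proof (induction j)
    case 0
    show ?case using step[of 0] by simp
  next
    case (Suc j)
    let ?F = "gen_by M {0..\<tau> (Suc j)} borel B"
    have m: "B (\<tau> i) \<in> borel_measurable ?F" if "i \<le> Suc j" for i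
      using that \<tau> strict_mono_less_eq[OF assms(3)] by (intro measurable_gen_by) auto
    have 1: "sets (gen_by M {0..\<tau> 0} borel B) \<subseteq> sets ?F"
      using strict_mono_less_eq[OF assms(3), of 0 "Suc j"]
      by (intro sets_gen_by_subset measurable_gen_by) auto
    have 2: "(\<lambda>\<omega>. \<Sum>i<Suc j. a i *\<^sub>R (B (\<tau> (Suc i)) \<omega> - B (\<tau> i) \<omega>)) \<in> borel_measurable ?F"
      by (intro borel_measurable_sum borel_measurable_scaleR borel_measurable_diff m borel_measurable_const) auto
    have pos: "0 < (a i)\<^sup>2 * (\<tau> (Suc i) - \<tau> i)" for i
      using a[of i] \<tau>[of i] by simp
    have "0 < (\<Sum>i<Suc j. (a i)\<^sup>2 * (\<tau> (Suc i) - \<tau> i))"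
      by (intro sum_pos pos) auto
    from indep_law_add[OF M[of 0] sub sub 1 Suc 2 step this pos]
    show ?case
      unfolding sum.lessThan_Suc[of _ "Suc j"] by simp
  qed
qed

section \<open>Pathwise Wiener integral and its law\<close>

text \<open>Left endpoints as in an Ito sum. Vector-valued generality pays off twice: with a
  Brownian path it is the random sum, and with the identity path and rate \<open>2 * m\<close> it is
  the variance of that sum.\<close>

definition exp_sum :: "real \<Rightarrow> (real \<Rightarrow> 'a::real_vector) \<Rightarrow> real \<Rightarrow> real \<Rightarrow> nat \<Rightarrow> 'a" where
  "exp_sum m \<beta> s t n = (let \<tau> = (\<lambda>i. s + (t - s) * real i / real n)
     in \<Sum>i<n. exp (m * \<tau> i) *\<^sub>R (\<beta> (\<tau> (Suc i)) - \<beta> (\<tau> i)))"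

text \<open>The pathwise Wiener integral of \<open>\<lambda>u. exp (m * u)\<close>, as a limit of nonanticipating sums: this keeps it
  adapted everywhere, although the limit only makes sense on continuous paths.\<close>

definition exp_wiener_integral :: "real \<Rightarrow> (real \<Rightarrow> 'a::real_normed_vector) \<Rightarrow> real \<Rightarrow> 'a" where
  "exp_wiener_integral m \<beta> t = lim (exp_sum m \<beta> 0 t)"

text \<open>Mean value inequality on one grid cell: subtracting
  \<open>exp (m * u) *\<^sub>R y\<close> replaces \<open>\<beta> u\<close> in the derivative by the
  small \<open>\<beta> u - y\<close>, which is dominated by the derivative of
  \<open>\<epsilon> * exp (m * u)\<close>. These bounds telescope over the cells.\<close>

lemma exp_increment_bound:
  fixes \<beta> H :: "real \<Rightarrow> 'a::real_normed_vector"
  assumes "a \<le> b" "m > 0"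
    and H: "\<And>u. u \<in> {a..b} \<Longrightarrow> (H has_vector_derivative (m * exp (m * u)) *\<^sub>R \<beta> u) (at u within {a..b})"
    and \<epsilon>: "\<And>u. u \<in> {a..b} \<Longrightarrow> norm (\<beta> u - y) \<le> \<epsilon>"
  shows "norm ((H b - exp (m * b) *\<^sub>R y) - (H a - exp (m * a) *\<^sub>R y)) \<le> \<epsilon> * exp (m * b) - \<epsilon> * exp (m * a)"
proof (cases "a = b")
  case False
  then have "a < b" using assms by simp
  then show ?thesis
  proof (rule differentiable_bound_general[where f="\<lambda>u. H u - exp (m * u) *\<^sub>R y" and \<phi>="\<lambda>u. \<epsilon> * exp (m * u)"
        and f'="\<lambda>u. (m * exp (m * u)) *\<^sub>R (\<beta> u - y)" and \<phi>'="\<lambda>u. \<epsilon> * (m * exp (m * u))"])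
    have "continuous_on {a..b} H"
      using H by (meson continuous_on_eq_continuous_within has_vector_derivative_continuous)
    then show "continuous_on {a..b} (\<lambda>u. H u - exp (m * u) *\<^sub>R y)"
      by (intro continuous_intros)
    fix u assume u: "a < u" "u < b"
    then have "(H has_vector_derivative (m * exp (m * u)) *\<^sub>R \<beta> u) (at u)"
      using H[of u] at_within_interior[of u "{a..b}"] by auto
    then show "((\<lambda>u. H u - exp (m * u) *\<^sub>R y) has_vector_derivative (m * exp (m * u)) *\<^sub>R (\<beta> u - y)) (at u)"
      by (auto intro!: derivative_eq_intros simp: scaleR_diff_right)
    show "((\<lambda>u. \<epsilon> * exp (m * u)) has_vector_derivative \<epsilon> * (m * exp (m * u))) (at u)"
      unfolding has_real_derivative_iff_has_vector_derivative[symmetric]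
      by (auto intro!: derivative_eq_intros)
    show "norm ((m * exp (m * u)) *\<^sub>R (\<beta> u - y)) \<le> \<epsilon> * (m * exp (m * u))"
      using \<epsilon>[of u] u \<open>m > 0\<close> by (simp add: mult.commute mult_right_mono)
  qed (intro continuous_intros)
qed simp

text \<open>Summation by parts turns the sum into a Riemann-Stieltjes sum of \<open>\<beta>\<close> against \<open>\<lambda>u. exp (m * u)\<close>.\<close>

lemma exp_sum_LIMSEQ:
  fixes \<beta> H :: "real \<Rightarrow> 'a::real_normed_vector"
  assumes "s \<le> t" "m > 0" and \<beta>: "continuous_on {s..t} \<beta>"
    and H: "\<And>u. u \<in> {s..t} \<Longrightarrow> (H has_vector_derivative (m * exp (m * u)) *\<^sub>R \<beta> u) (at u within {s..t})"
  shows "exp_sum m \<beta> s t \<longlonglongrightarrow> (exp (m * t) *\<^sub>R \<beta> t - H t) - (exp (m * s) *\<^sub>R \<beta> s - H s)"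
proof (rule LIMSEQ_I)
  fix r :: real assume "r > 0"
  \<comment> \<open>The summed cell errors telescope to
    \<open>\<epsilon> * (exp (m * t) - exp (m * s))\<close>; the extra 1 keeps \<open>K\<close>
    positive when \<open>s = t\<close> and makes the final bound strict.\<close>
  define K where "K = exp (m * t) - exp (m * s) + 1"
  define \<epsilon> where "\<epsilon> = r / K"
  have "exp (m * t) \<ge> exp (m * s)" using assms by simp
  then have "K > 0" unfolding K_def by linarith
  then have "\<epsilon> > 0" using \<open>r > 0\<close> by (simp add: \<epsilon>_def)
  obtain \<delta> where "\<delta> > 0" and \<delta>: "\<And>u u'. u \<in> {s..t} \<Longrightarrow> u' \<in> {s..t} \<Longrightarrow> dist u' u < \<delta> \<Longrightarrow> dist (\<beta> u') (\<beta> u) < \<epsilon>"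
    using compact_uniformly_continuous[OF \<beta>] \<open>\<epsilon> > 0\<close> unfolding uniformly_continuous_on_def by fastforce
  obtain N :: nat where N: "(t - s) / \<delta> < real N" using reals_Archimedean2 by blast
  show "\<exists>no. \<forall>n\<ge>no. norm (exp_sum m \<beta> s t n - ((exp (m * t) *\<^sub>R \<beta> t - H t) - (exp (m * s) *\<^sub>R \<beta> s - H s))) < r"
  proof (intro exI[of _ "Suc N"] allI impI)
    fix n assume n: "Suc N \<le> n"
    define \<tau> where "\<tau> i = s + (t - s) * real i / real n" for i
    define \<Phi> where "\<Phi> u = exp (m * u) *\<^sub>R \<beta> u - H u" for u
    have ends: "\<tau> 0 = s" "\<tau> n = t" using n by (auto simp: \<tau>_def)
    have mesh: "\<tau> i \<le> \<tau> (Suc i)" "\<tau> (Suc i) - \<tau> i < \<delta>" for i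
    proof -
      have d: "\<tau> (Suc i) - \<tau> i = (t - s) / real n"
        using n by (simp add: \<tau>_def field_simps)
      then show "\<tau> i \<le> \<tau> (Suc i)" using \<open>s \<le> t\<close> by (metis diff_ge_0_iff_ge divide_nonneg_nonneg of_nat_0_le_iff)
      have "(t - s) / \<delta> < real n" using N n by simp
      then have "t - s < real n * \<delta>" using \<open>\<delta> > 0\<close> by (simp add: field_simps)
      then show "\<tau> (Suc i) - \<tau> i < \<delta>"
        using n unfolding d by (simp add: field_simps)
    qed
    have in_st: "\<tau> i \<in> {s..t}" if "i \<le> n" for i
    proof -
      have "(t - s) * real i / real n \<le> (t - s) * 1" "0 \<le> (t - s) * real i / real n"
        using that n \<open>s \<le> t\<close> by (auto simp: divide_simps intro!: mult_left_mono)
      then show ?thesis by (simp add: \<tau>_def)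
    qed
    have summand: "norm (exp (m * \<tau> i) *\<^sub>R (\<beta> (\<tau> (Suc i)) - \<beta> (\<tau> i)) - (\<Phi> (\<tau> (Suc i)) - \<Phi> (\<tau> i))) \<le>
        \<epsilon> * exp (m * \<tau> (Suc i)) - \<epsilon> * exp (m * \<tau> i)" if "i < n" for i
    proof -
      let ?y = "\<beta> (\<tau> (Suc i))"
      have sub: "{\<tau> i..\<tau> (Suc i)} \<subseteq> {s..t}"
        using in_st[of i] in_st[of "Suc i"] that by auto
      have "norm ((H (\<tau> (Suc i)) - exp (m * \<tau> (Suc i)) *\<^sub>R ?y) - (H (\<tau> i) - exp (m * \<tau> i) *\<^sub>R ?y)) \<le>
        \<epsilon> * exp (m * \<tau> (Suc i)) - \<epsilon> * exp (m * \<tau> i)"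
      proof (rule exp_increment_bound[OF mesh(1) \<open>m > 0\<close>])
        fix u assume u: "u \<in> {\<tau> i..\<tau> (Suc i)}"
        then show "(H has_vector_derivative (m * exp (m * u)) *\<^sub>R \<beta> u) (at u within {\<tau> i..\<tau> (Suc i)})"
          using H[of u] sub by (meson has_vector_derivative_within_subset subsetD)
        have "dist u (\<tau> (Suc i)) < \<delta>"
          using u mesh(2)[of i] by (auto simp: dist_real_def)
        then show "norm (\<beta> u - ?y) \<le> \<epsilon>"
          using \<delta>[of "\<tau> (Suc i)" u] u sub in_st[of "Suc i"] that by (auto simp: dist_norm)
      qed
      moreover have "exp (m * \<tau> i) *\<^sub>R (\<beta> (\<tau> (Suc i)) - \<beta> (\<tau> i)) - (\<Phi> (\<tau> (Suc i)) - \<Phi> (\<tau> i)) =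
        (H (\<tau> (Suc i)) - exp (m * \<tau> (Suc i)) *\<^sub>R ?y) - (H (\<tau> i) - exp (m * \<tau> i) *\<^sub>R ?y)"
        by (simp add: \<Phi>_def algebra_simps)
      ultimately show ?thesis by simp
    qed
    have "exp_sum m \<beta> s t n - (\<Phi> t - \<Phi> s) =
        (\<Sum>i<n. exp (m * \<tau> i) *\<^sub>R (\<beta> (\<tau> (Suc i)) - \<beta> (\<tau> i)) - (\<Phi> (\<tau> (Suc i)) - \<Phi> (\<tau> i)))"
      using sum_lessThan_telescope[of "\<lambda>i. \<Phi> (\<tau> i)" n]
      by (simp only: sum_subtractf[of _ "\<lambda>i. \<Phi> (\<tau> (Suc i)) - \<Phi> (\<tau> i)"] exp_sum_def Let_def \<tau>_def[symmetric] ends)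
    also have "norm \<dots> \<le> (\<Sum>i<n. \<epsilon> * exp (m * \<tau> (Suc i)) - \<epsilon> * exp (m * \<tau> i))"
      by (intro sum_norm_le summand) auto
    also have "\<dots> = \<epsilon> * exp (m * t) - \<epsilon> * exp (m * s)"
      unfolding sum_lessThan_telescope[of "\<lambda>i. \<epsilon> * exp (m * \<tau> i)"] ends ..
    also have "\<dots> < \<epsilon> * K"
      using \<open>\<epsilon> > 0\<close> by (simp add: K_def algebra_simps)
    also have "\<dots> = r"
      using \<open>K > 0\<close> by (simp add: \<epsilon>_def)
    finally show "norm (exp_sum m \<beta> s t n - ((exp (m * t) *\<^sub>R \<beta> t - H t) - (exp (m * s) *\<^sub>R \<beta> s - H s))) < r"
      by (simp add: \<Phi>_def)
  qed
qed

definition exp_primitive :: "real \<Rightarrow> (real \<Rightarrow> 'a::euclidean_space) \<Rightarrow> real \<Rightarrow> 'a" where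
  "exp_primitive m \<beta> t = integral {0..t} (\<lambda>u. (m * exp (m * u)) *\<^sub>R \<beta> u)"

lemma exp_primitive_0 [simp]: "exp_primitive m \<beta> 0 = 0"
  by (simp add: exp_primitive_def)

lemma exp_primitive_has_vector_derivative:
  assumes "continuous_on {0..} \<beta>" "u \<in> {0..T}"
  shows "(exp_primitive m \<beta> has_vector_derivative (m * exp (m * u)) *\<^sub>R \<beta> u) (at u within {0..T})"
  unfolding exp_primitive_def[abs_def]
  by (rule integral_has_vector_derivative[OF _ assms(2)])
    (intro continuous_intros continuous_on_subset[OF assms(1)], auto)

lemma exp_sum_LIMSEQ_primitive:
  fixes \<beta> :: "real \<Rightarrow> 'a::euclidean_space"
  assumes "continuous_on {0..} \<beta>" "m > 0" "0 \<le> s" "s \<le> t"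
  shows "exp_sum m \<beta> s t \<longlonglongrightarrow>
    (exp (m * t) *\<^sub>R \<beta> t - exp_primitive m \<beta> t) - (exp (m * s) *\<^sub>R \<beta> s - exp_primitive m \<beta> s)"
proof (rule exp_sum_LIMSEQ[OF assms(4,2)])
  show "continuous_on {s..t} \<beta>"
    using assms by (auto intro: continuous_on_subset)
  show "(exp_primitive m \<beta> has_vector_derivative (m * exp (m * u)) *\<^sub>R \<beta> u) (at u within {s..t})"
    if "u \<in> {s..t}" for u
    using assms(3) that
    by (intro has_vector_derivative_within_subset[OF exp_primitive_has_vector_derivative[OF assms(1), of u t]]) auto
qed

lemma exp_wiener_integral_eq:
  fixes \<beta> :: "real \<Rightarrow> 'a::euclidean_space"
  assumes "continuous_on {0..} \<beta>" "m > 0" "0 \<le> t"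
  shows "exp_wiener_integral m \<beta> t = exp (m * t) *\<^sub>R \<beta> t - \<beta> 0 - exp_primitive m \<beta> t"
  using exp_sum_LIMSEQ_primitive[OF assms(1,2), of 0 t] assms(3)
  by (simp add: exp_wiener_integral_def limI)

text \<open>The integral is defined through grids starting at 0. The closed form shows that its
  increment is also a limit over grids starting at \<open>s\<close>, which involve only increments
  after \<open>s\<close>.\<close>

lemma exp_sum_LIMSEQ_exp_wiener_integral:
  fixes \<beta> :: "real \<Rightarrow> 'a::euclidean_space"
  assumes "continuous_on {0..} \<beta>" "m > 0" "0 \<le> s" "s \<le> t"
  shows "exp_sum m \<beta> s t \<longlonglongrightarrow> exp_wiener_integral m \<beta> t - exp_wiener_integral m \<beta> s"
  using exp_sum_LIMSEQ_primitive[OF assms] assms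
  by (simp add: exp_wiener_integral_eq algebra_simps)

text \<open>All grid points lie in \<open>{0..t}\<close>, and where the sums diverge
  \<open>lim\<close> is a fixed default value, so no assumption on the paths is required.\<close>

lemma measurable_exp_wiener_integral:
  fixes B :: "real \<Rightarrow> 'w \<Rightarrow> 'a::euclidean_space"
  assumes "\<And>u. 0 \<le> u \<Longrightarrow> u \<le> t \<Longrightarrow> B u \<in> borel_measurable F" "0 \<le> t"
  shows "(\<lambda>\<omega>. exp_wiener_integral m (\<lambda>u. B u \<omega>) t) \<in> borel_measurable F"
  unfolding exp_wiener_integral_def exp_sum_def Let_def
proof (intro borel_measurable_lim_metric borel_measurable_sum borel_measurable_scaleR
    borel_measurable_diff borel_measurable_const assms)
  fix n i assume "i \<in> {..<n::nat}"
  then have "t * real i / real n \<le> t" "t * real (Suc i) / real n \<le> t"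
    using \<open>0 \<le> t\<close> by (auto simp: divide_simps intro!: mult_left_mono)
  then show "0 + (t - 0) * real i / real n \<le> t" "0 + (t - 0) * real (Suc i) / real n \<le> t"
    by simp_all
qed (use assms in auto)

lemma exp_wiener_integral_indep_law:
  fixes B :: "real \<Rightarrow> 'w \<Rightarrow> 'a::euclidean_space"
  assumes B: "std_brownian_motion M B" and "m > 0" "0 \<le> s" "s < t"
  shows "indep_law M (gen_by M {0..s} borel B)
    (\<lambda>\<omega>. exp_wiener_integral m (\<lambda>u. B u \<omega>) t - exp_wiener_integral m (\<lambda>u. B u \<omega>) s)
    (iso_gauss ((exp (2 * m * t) - exp (2 * m * s)) / (2 * m)))"
proof -
  have M: "prob_space M" and Bm[measurable]: "\<And>u. u \<ge> 0 \<Longrightarrow> B u \<in> borel_measurable M"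
    and cont: "AE \<omega> in M. continuous_on {0..} (\<lambda>t. B t \<omega>)"
    using B by (auto simp: std_brownian_motion_def)
  \<comment> \<open>Grids with \<open>Suc n\<close> cells avoid division by zero and match the
    nonempty sums of \<open>brownian_sum_indep_law\<close>.\<close>
  define \<tau> where "\<tau> n i = s + (t - s) * real i / real n" for n i :: nat
  define v where "v n = (\<Sum>i<Suc n. (exp (m * \<tau> (Suc n) i))\<^sup>2 * (\<tau> (Suc n) (Suc i) - \<tau> (Suc n) i))" for n
  \<comment> \<open>A primitive of \<open>2 * m * exp (2 * m * u) * u\<close>. With it the
    deterministic case of \<open>exp_sum_LIMSEQ\<close>, at rate \<open>2 * m\<close> and for the
    identity path, evaluates the limit of the variances as the integral of
    \<open>exp (2 * m * u)\<close> over \<open>{s..t}\<close>.\<close>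
  let ?H = "\<lambda>u. u * exp (2 * m * u) - exp (2 * m * u) / (2 * m)"
  have "exp_sum (2 * m) (\<lambda>u. u) s t \<longlonglongrightarrow>
      (exp (2 * m * t) *\<^sub>R t - ?H t) - (exp (2 * m * s) *\<^sub>R s - ?H s)"
  proof (rule exp_sum_LIMSEQ)
    fix u
    show "(?H has_vector_derivative (2 * m * exp (2 * m * u)) *\<^sub>R u) (at u within {s..t})"
      unfolding has_real_derivative_iff_has_vector_derivative[symmetric]
      using \<open>m > 0\<close> by (auto intro!: derivative_eq_intros simp: field_simps)
  qed (use assms in \<open>auto intro: continuous_intros\<close>)
  then have "(\<lambda>n. exp_sum (2 * m) (\<lambda>u. u) s t (Suc n)) \<longlonglongrightarrow> (exp (2 * m * t) - exp (2 * m * s)) / (2 * m)"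
    by (subst filterlim_sequentially_Suc) (simp add: diff_divide_distrib algebra_simps)
  moreover have "exp_sum (2 * m) (\<lambda>u. u) s t (Suc n) = v n" for n
    by (simp add: exp_sum_def v_def \<tau>_def Let_def exp_double[symmetric] mult.assoc del: sum.lessThan_Suc of_nat_Suc)
  ultimately have v: "v \<longlonglongrightarrow> (exp (2 * m * t) - exp (2 * m * s)) / (2 * m)"
    by simp
  show ?thesis
  proof (rule indep_law_LIMSEQ[OF M _ _ _ _ v])
    show "subalgebra M (gen_by M {0..s} borel B)"
      using Bm by (intro subalgebra_gen_by) auto
    show "indep_law M (gen_by M {0..s} borel B) (\<lambda>\<omega>. exp_sum m (\<lambda>u. B u \<omega>) s t (Suc n)) (iso_gauss (v n))" for n
    proof -
      have "strict_mono (\<tau> (Suc n))"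
        using \<open>s < t\<close> by (auto simp: strict_mono_def \<tau>_def divide_simps simp del: of_nat_Suc)
      from brownian_sum_indep_law[OF B _ this, of "\<lambda>i. exp (m * \<tau> (Suc n) i)" n]
      show ?thesis
        using \<open>0 \<le> s\<close> by (simp add: exp_sum_def Let_def v_def \<tau>_def del: sum.lessThan_Suc of_nat_Suc)
    qed
    have "(\<lambda>\<omega>. exp_wiener_integral m (\<lambda>u. B u \<omega>) r) \<in> borel_measurable M" if "r \<ge> 0" for r
      using that Bm by (intro measurable_exp_wiener_integral) auto
    then show "(\<lambda>\<omega>. exp_wiener_integral m (\<lambda>u. B u \<omega>) t - exp_wiener_integral m (\<lambda>u. B u \<omega>) s) \<in> borel_measurable M"
      using assms by (intro borel_measurable_diff) auto
    show "AE \<omega> in M. (\<lambda>n. exp_sum m (\<lambda>u. B u \<omega>) s t (Suc n)) \<longlonglongrightarrow>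
        exp_wiener_integral m (\<lambda>u. B u \<omega>) t - exp_wiener_integral m (\<lambda>u. B u \<omega>) s"
      using cont by eventually_elim
        (use assms in \<open>auto intro!: LIMSEQ_Suc exp_sum_LIMSEQ_exp_wiener_integral\<close>)
  qed
qed

section \<open>The Ornstein-Uhlenbeck process\<close>

text \<open>The flow after time \<open>r\<close> of the noiseless equation
  \<open>x' = - (m x + v)\<close>, which contracts towards its fixed point
  \<open>- v / m\<close>.\<close>

definition ou_mean :: "real \<Rightarrow> 'a::real_vector \<Rightarrow> real \<Rightarrow> 'a \<Rightarrow> 'a" where
  "ou_mean m v r x = exp (- (m * r)) *\<^sub>R (x + (1 / m) *\<^sub>R v) - (1 / m) *\<^sub>R v"

text \<open>This is twice the integral of \<open>exp (- 2 m u)\<close> over \<open>{0..r}\<close>,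
  the variance of each coordinate of the noise accumulated in time \<open>r\<close>.\<close>

definition ou_var :: "real \<Rightarrow> real \<Rightarrow> real" where
  "ou_var m r = (1 - exp (- (2 * m * r))) / m"

definition ou_path :: "real \<Rightarrow> 'a::euclidean_space \<Rightarrow> 'a \<Rightarrow> (real \<Rightarrow> 'a) \<Rightarrow> real \<Rightarrow> 'a" where
  "ou_path m v \<xi> \<beta> t = ou_mean m v t \<xi> + (sqrt 2 * exp (- (m * t))) *\<^sub>R exp_wiener_integral m \<beta> t"

lemma ou_var_pos: "m > 0 \<Longrightarrow> r > 0 \<Longrightarrow> ou_var m r > 0"
  by (simp add: ou_var_def)

lemma exp_wiener_integral_0 [simp]: "exp_wiener_integral m \<beta> 0 = 0"
  by (simp add: exp_wiener_integral_def exp_sum_def[abs_def] limI)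

lemma ou_path_0 [simp]: "ou_path m v \<xi> \<beta> 0 = \<xi>"
  by (simp add: ou_path_def ou_mean_def)

text \<open>The flow property of \<open>ou_mean\<close> together with a splitting of the Wiener term
  at time \<open>s\<close>. It is purely algebraic, so it holds on every path, continuous or
  not.\<close>

lemma ou_path_increment:
  "ou_path m v \<xi> \<beta> t = ou_mean m v (t - s) (ou_path m v \<xi> \<beta> s) +
    (sqrt 2 * exp (- (m * t))) *\<^sub>R (exp_wiener_integral m \<beta> t - exp_wiener_integral m \<beta> s)"
proof -
  have "exp (- (m * (t - s))) * exp (- (m * s)) = exp (- (m * t))"
    by (simp add: exp_add[symmetric] algebra_simps)
  then have "exp (- (m * (t - s))) *\<^sub>R (exp (- (m * s)) *\<^sub>R x) = exp (- (m * t)) *\<^sub>R x" for x :: 'a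
    by simp
  then show ?thesis
    by (simp add: ou_path_def ou_mean_def scaleR_add_right scaleR_diff_right mult.commute[of "sqrt 2"] scaleR_scaleR[symmetric]
        del: scaleR_scaleR)
qed

lemma exp_primitive_continuous_on:
  assumes "continuous_on {0..} \<beta>"
  shows "continuous_on {0..} (exp_primitive m \<beta>)"
  unfolding continuous_on_eq_continuous_within
proof
  fix u :: real assume "u \<in> {0..}"
  then have "continuous (at u within {0..u + 1}) (exp_primitive m \<beta>)"
    using exp_primitive_has_vector_derivative[OF assms, of u "u + 1"]
    by (auto dest: has_vector_derivative_continuous)
  \<comment> \<open>Differentiability is available on bounded intervals only; ending the interval
    strictly beyond \<open>u\<close> makes the two filters agree.\<close>
  moreover have "at u within {0..u + 1} = at u within {0..}"
    by (rule at_within_nhd[of u "{..<u + 1}"]) auto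
  ultimately show "continuous (at u within {0..}) (exp_primitive m \<beta>)"
    by simp
qed

text \<open>The boundary term \<open>exp (m * t) *\<^sub>R \<beta> t\<close> is undone by the
  damping factor. What remains besides \<open>sqrt 2 *\<^sub>R \<beta> t\<close> is differentiable
  in \<open>t\<close>.\<close>

lemma ou_path_eq:
  assumes "continuous_on {0..} \<beta>" "\<beta> 0 = 0" "m > 0" "t \<ge> 0"
  shows "ou_path m v \<xi> \<beta> t =
    exp (- (m * t)) *\<^sub>R (\<xi> + (1 / m) *\<^sub>R v - sqrt 2 *\<^sub>R exp_primitive m \<beta> t) - (1 / m) *\<^sub>R v + sqrt 2 *\<^sub>R \<beta> t"
proof -
  have "exp (- (m * t)) * exp (m * t) = 1"
    by (simp add: exp_add[symmetric])
  then show ?thesis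
    using assms
    by (simp add: ou_path_def ou_mean_def exp_wiener_integral_eq scaleR_diff_right scaleR_add_right mult.commute mult.left_commute)
qed

lemma ou_path_continuous_on:
  assumes "continuous_on {0..} \<beta>" "\<beta> 0 = 0" "m > 0"
  shows "continuous_on {0..} (ou_path m v \<xi> \<beta>)"
proof -
  have "continuous_on {0..} (\<lambda>t. exp (- (m * t)) *\<^sub>R (\<xi> + (1 / m) *\<^sub>R v - sqrt 2 *\<^sub>R exp_primitive m \<beta> t) -
      (1 / m) *\<^sub>R v + sqrt 2 *\<^sub>R \<beta> t)"
    by (intro continuous_intros assms(1) exp_primitive_continuous_on)
  then show ?thesis
    by (rule continuous_on_cong[THEN iffD2, OF refl, rotated]) (simp add: ou_path_eq[OF assms])
qed

lemma set_integrable_affine_drift: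
  fixes x :: "real \<Rightarrow> 'a::euclidean_space"
  assumes "continuous_on {0..} x"
  shows "set_integrable lborel {0..t} (\<lambda>s. - (m *\<^sub>R x s + v))"
  by (intro borel_integrable_atLeastAtMost' continuous_intros continuous_on_subset[OF assms]) auto

lemma ou_path_solves:
  fixes \<beta> :: "real \<Rightarrow> 'a::euclidean_space"
  assumes \<beta>: "continuous_on {0..} \<beta>" "\<beta> 0 = 0" and "m > 0" "t \<ge> 0"
  shows "ou_path m v \<xi> \<beta> t =
    \<xi> + (LINT s:{0..t}|lborel. - (m *\<^sub>R ou_path m v \<xi> \<beta> s + v)) + sqrt 2 *\<^sub>R \<beta> t"
proof -
  \<comment> \<open>The solution minus its noise. Unlike the path itself it is continuously
    differentiable, and its derivative is the drift, so the fundamental theorem of calculus gives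
    the integral equation.\<close>
  define D where "D u = exp (- (m * u)) *\<^sub>R (\<xi> + (1 / m) *\<^sub>R v - sqrt 2 *\<^sub>R exp_primitive m \<beta> u) - (1 / m) *\<^sub>R v" for u
  have D: "ou_path m v \<xi> \<beta> u = D u + sqrt 2 *\<^sub>R \<beta> u" if "u \<ge> 0" for u
    using ou_path_eq[OF \<beta> \<open>m > 0\<close> that] by (simp add: D_def)
  have "(LINT s:{0..t}|lborel. - (m *\<^sub>R ou_path m v \<xi> \<beta> s + v)) = D t - D 0"
    unfolding set_lebesgue_integral_def
  proof (rule integral_FTC_atLeastAtMost[OF \<open>t \<ge> 0\<close>])
    show "continuous_on {0..t} (\<lambda>s. - (m *\<^sub>R ou_path m v \<xi> \<beta> s + v))"
      by (intro continuous_intros continuous_on_subset[OF ou_path_continuous_on[OF \<beta> \<open>m > 0\<close>]]) auto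
    fix u assume u: "0 \<le> u" "u \<le> t"
    have P: "(exp_primitive m \<beta> has_vector_derivative (m * exp (m * u)) *\<^sub>R \<beta> u) (at u within {0..t})"
      using u by (intro exp_primitive_has_vector_derivative \<beta>) auto
    have e: "exp (- (m * u)) * exp (m * u) = 1"
      by (simp add: exp_add[symmetric])
    have "(D has_vector_derivative
        (exp (- (m * u)) *\<^sub>R (- (sqrt 2 *\<^sub>R (m * exp (m * u)) *\<^sub>R \<beta> u)) +
         (- (m * exp (- (m * u)))) *\<^sub>R (\<xi> + (1 / m) *\<^sub>R v - sqrt 2 *\<^sub>R exp_primitive m \<beta> u))) (at u within {0..t})"
      unfolding D_def[abs_def] by (auto intro!: derivative_eq_intros P)
    also have "(exp (- (m * u)) *\<^sub>R (- (sqrt 2 *\<^sub>R (m * exp (m * u)) *\<^sub>R \<beta> u)) +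
         (- (m * exp (- (m * u)))) *\<^sub>R (\<xi> + (1 / m) *\<^sub>R v - sqrt 2 *\<^sub>R exp_primitive m \<beta> u)) =
         - ((exp (- (m * u)) * exp (m * u)) *\<^sub>R (m * sqrt 2) *\<^sub>R \<beta> u) - m *\<^sub>R (D u + (1 / m) *\<^sub>R v)"
      by (simp add: D_def mult.commute mult.left_commute)
    also have "\<dots> = - (m *\<^sub>R ou_path m v \<xi> \<beta> u + v)"
      unfolding e using u \<open>m > 0\<close> by (simp add: D scaleR_add_right)
    finally show "(D has_vector_derivative - (m *\<^sub>R ou_path m v \<xi> \<beta> u + v)) (at u within {0..t})" .
  qed
  moreover have "D 0 = \<xi>" by (simp add: D_def)
  ultimately show ?thesis
    using D[OF \<open>t \<ge> 0\<close>] by simp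
qed

lemma ou_path_unique:
  fixes \<beta> x :: "real \<Rightarrow> 'a::euclidean_space"
  assumes \<beta>: "continuous_on {0..} \<beta>" "\<beta> 0 = 0" and "m > 0" and x: "continuous_on {0..} x"
    and eq: "\<And>t. t \<ge> 0 \<Longrightarrow> x t = \<xi> + (LINT s:{0..t}|lborel. - (m *\<^sub>R x s + v)) + sqrt 2 *\<^sub>R \<beta> t"
    and "t \<ge> 0"
  shows "x t = ou_path m v \<xi> \<beta> t"
proof -
  define D where "D u = \<xi> + integral {0..u} (\<lambda>s. - (m *\<^sub>R x s + v))" for u
  have D: "x u = D u + sqrt 2 *\<^sub>R \<beta> u" if "u \<ge> 0" for u
    using eq[OF that] set_integrable_affine_drift[OF x, of u m v]
    by (simp add: D_def set_borel_integral_eq_integral)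
  \<comment> \<open>Integrating factor: \<open>exp (m * u)\<close> cancels the linear drift of
    \<open>D\<close>, and the last summand cancels the forcing by \<open>\<beta>\<close>, so
    \<open>E\<close> is constant and determines \<open>D\<close>.\<close>
  define E where "E u = exp (m * u) *\<^sub>R (D u + (1 / m) *\<^sub>R v) + sqrt 2 *\<^sub>R exp_primitive m \<beta> u" for u
  have "(E has_vector_derivative 0) (at u within {0..t})" if u: "u \<in> {0..t}" for u
  proof -
    have "(D has_vector_derivative - (m *\<^sub>R x u + v)) (at u within {0..t})"
      unfolding D_def
      by (auto intro!: derivative_eq_intros integral_has_vector_derivative[OF _ u] continuous_intros
          continuous_on_subset[OF x])
    then have "(E has_vector_derivative
        (exp (m * u) *\<^sub>R (- (m *\<^sub>R x u + v)) + (m * exp (m * u)) *\<^sub>R (D u + (1 / m) *\<^sub>R v)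
          + sqrt 2 *\<^sub>R (m * exp (m * u)) *\<^sub>R \<beta> u)) (at u within {0..t})"
      unfolding E_def[abs_def]
      by (auto intro!: derivative_eq_intros exp_primitive_has_vector_derivative[OF \<beta>(1) u])
    also have "(exp (m * u) *\<^sub>R (- (m *\<^sub>R x u + v)) + (m * exp (m * u)) *\<^sub>R (D u + (1 / m) *\<^sub>R v)
          + sqrt 2 *\<^sub>R (m * exp (m * u)) *\<^sub>R \<beta> u) =
        exp (m * u) *\<^sub>R (- (m *\<^sub>R x u + v) + m *\<^sub>R (D u + sqrt 2 *\<^sub>R \<beta> u) + v)"
      using \<open>m > 0\<close> by (simp add: algebra_simps)
    also have "\<dots> = 0"
      using D[of u] u by simp
    finally show ?thesis .
  qed
  then have "((\<lambda>_. 0) has_integral (E t - E 0)) {0..t}"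
    using \<open>t \<ge> 0\<close> by (rule fundamental_theorem_of_calculus[rotated])
  then have "E t = E 0"
    using has_integral_unique[OF _ has_integral_0] by fastforce
  also have "E 0 = \<xi> + (1 / m) *\<^sub>R v"
    by (simp add: E_def D_def)
  finally have "exp (m * t) *\<^sub>R (D t + (1 / m) *\<^sub>R v) = \<xi> + (1 / m) *\<^sub>R v - sqrt 2 *\<^sub>R exp_primitive m \<beta> t"
    by (simp add: E_def algebra_simps)
  then have "exp (- (m * t)) *\<^sub>R exp (m * t) *\<^sub>R (D t + (1 / m) *\<^sub>R v) =
      exp (- (m * t)) *\<^sub>R (\<xi> + (1 / m) *\<^sub>R v - sqrt 2 *\<^sub>R exp_primitive m \<beta> t)"
    by simp
  then have "D t = exp (- (m * t)) *\<^sub>R (\<xi> + (1 / m) *\<^sub>R v - sqrt 2 *\<^sub>R exp_primitive m \<beta> t) - (1 / m) *\<^sub>R v"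
    by (simp add: exp_add[symmetric] eq_diff_eq)
  then show ?thesis
    using D[OF \<open>t \<ge> 0\<close>] ou_path_eq[OF \<beta> \<open>m > 0\<close> \<open>t \<ge> 0\<close>, of v \<xi>] by simp
qed

section \<open>Conditional laws under independent additive noise\<close>

text \<open>Supplies the degenerate noise for the case \<open>s = t\<close> of the Markov
  property.\<close>

lemma indep_law_0:
  fixes F :: "'w measure"
  assumes "prob_space M" "subalgebra M F"
  shows "indep_law M F (\<lambda>_. 0 :: 'a::euclidean_space) (return borel 0)"
  unfolding indep_law_def
proof safe
  fix G and C :: "'a set" assume "G \<in> sets F" "C \<in> sets borel"
  then show "emeasure M (G \<inter> ((\<lambda>_. 0) -` C \<inter> space M)) = emeasure M G * emeasure (return borel 0) C"
    using subalgebra_sets[OF assms(2), of G] sets.sets_into_space[of G M]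
    by (cases "(0::'a) \<in> C") (auto simp: Int_absorb2)
qed simp

lemma measurable_translation_kernel:
  fixes \<nu> :: "'a::euclidean_space measure"
  assumes "prob_space \<nu>" "sets \<nu> = sets borel" and [measurable]: "\<phi> \<in> borel_measurable N"
  shows "(\<lambda>x. distr \<nu> borel (\<lambda>y. \<phi> x + y)) \<in> N \<rightarrow>\<^sub>M prob_algebra borel"
proof (rule measurable_distr_prob_space2[where M=borel])
  show "(\<lambda>x. \<nu>) \<in> N \<rightarrow>\<^sub>M prob_algebra borel"
    using assms by (intro measurable_const) (simp add: space_prob_algebra)
qed measurable

text \<open>Given \<open>F\<close>, the argument \<open>X\<close> is frozen and only
  \<open>W\<close> stays random. The candidate is verified by comparing integrals over sets of
  \<open>F\<close>, where the freezing principle applies; there an almost sure representation of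
  \<open>Y\<close> is enough.\<close>

lemma real_cond_exp_indep_add:
  fixes X Y :: "'w \<Rightarrow> 'a::euclidean_space"
  assumes M: "prob_space M" and F: "subalgebra M F" and W: "indep_law M F W \<nu>"
    and \<nu>[measurable_cong]: "sets \<nu> = sets borel"
    and X[measurable]: "X \<in> borel_measurable F" and \<phi>[measurable]: "\<phi> \<in> borel_measurable borel"
    and Y[measurable]: "Y \<in> borel_measurable M" and YW: "AE \<omega> in M. Y \<omega> = \<phi> (X \<omega>) + W \<omega>"
    and A[measurable]: "A \<in> sets borel"
  shows "AE \<omega> in M. real_cond_exp M F (\<lambda>\<omega>'. indicator A (Y \<omega>')) \<omega> =
    measure (distr \<nu> borel (\<lambda>y. \<phi> (X \<omega>) + y)) A"
proof -
  interpret prob_space M by fact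
  interpret finite_measure_subalgebra M F
    using F by unfold_locales
  have Wm[measurable]: "W \<in> borel_measurable M"
    using W by (simp add: indep_law_def)
  have "prob_space \<nu>"
    using prob_space_distr[OF Wm] indep_law_distr[OF M F W \<nu>] by simp
  then interpret \<nu>: prob_space \<nu> .
  have Kp: "prob_space (distr \<nu> borel (\<lambda>y. \<phi> x + y))" for x
    by (rule \<nu>.prob_space_distr) simp
  have Km: "(\<lambda>x. measure (distr \<nu> borel (\<lambda>y. \<phi> x + y)) A) \<in> borel_measurable borel"
    using measurable_compose[OF measurable_prob_algebraD[OF measurable_translation_kernel[OF \<open>prob_space \<nu>\<close> \<nu> \<phi>]]
        measurable_measure_subprob_algebra[OF A]] by simp
  define g where "g \<omega> = measure (distr \<nu> borel (\<lambda>y. \<phi> (X \<omega>) + y)) A" for \<omega>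
  have gF[measurable]: "g \<in> borel_measurable F"
    unfolding g_def[abs_def] by (rule measurable_compose[OF X Km])
  have gM[measurable]: "g \<in> borel_measurable M"
    by (rule measurable_from_subalg[OF F gF])
  have g01: "0 \<le> g \<omega>" "g \<omega> \<le> 1" for \<omega>
    using prob_space.prob_le_1[OF Kp] by (auto simp: g_def)
  have g_eq: "ennreal (g \<omega>) = (\<integral>\<^sup>+y. indicator A (\<phi> (X \<omega>) + y) \<partial>\<nu>)" for \<omega>
    using finite_measure.emeasure_eq_measure[OF prob_space.finite_measure[OF Kp], of "X \<omega>" A]
    by (simp add: g_def nn_integral_distr[symmetric] flip: nn_integral_indicator)
      (simp add: nn_integral_distr del: nn_integral_indicator)
  show ?thesis
    unfolding g_def[symmetric]
  proof (rule real_cond_exp_charact)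
    fix G assume G[measurable]: "G \<in> sets F"
    then have [measurable]: "G \<in> sets M"
      by (rule subalgebra_sets[OF F])
    have "(\<integral>\<^sup>+\<omega>. ennreal (indicator G \<omega> * indicator A (Y \<omega>)) \<partial>M) =
        (\<integral>\<^sup>+\<omega>. indicator G \<omega> * indicator A (\<phi> (X \<omega>) + W \<omega>) \<partial>M)"
      using YW by (intro nn_integral_cong_AE) (auto elim!: eventually_mono split: split_indicator)
    also have "\<dots> = (\<integral>\<^sup>+\<omega>. \<integral>\<^sup>+y. indicator G \<omega> * indicator A (\<phi> (X \<omega>) + y) \<partial>\<nu> \<partial>M)"
      using indep_law_nn_integral[OF M F W \<nu>, of "\<lambda>(\<omega>, y). indicator G \<omega> * indicator A (\<phi> (X \<omega>) + y)"] by simp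
    also have "\<dots> = (\<integral>\<^sup>+\<omega>. ennreal (indicator G \<omega> * g \<omega>) \<partial>M)"
      by (intro nn_integral_cong) (auto simp: g_eq split: split_indicator)
    finally have "(\<integral>\<omega>. indicator G \<omega> * indicator A (Y \<omega>) \<partial>M) = (\<integral>\<omega>. indicator G \<omega> * g \<omega> \<partial>M)"
      using g01 by (simp add: integral_eq_nn_integral)
    then show "(\<integral>\<omega>\<in>G. indicator A (Y \<omega>) \<partial>M) = (\<integral>\<omega>\<in>G. g \<omega> \<partial>M)"
      by (simp add: set_lebesgue_integral_def)
  qed (use g01 in \<open>auto intro!: integrable_const_bound[where B=1] split: split_indicator\<close>)
qed

lemma cond_distribution_indep_add:
  fixes X Y :: "'w \<Rightarrow> 'a::euclidean_space"
  assumes M: "prob_space M" and X: "X \<in> borel_measurable M"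
    and W: "indep_law M (vimage_algebra (space M) X borel) W \<nu>"
    and \<nu>: "sets \<nu> = sets borel" and \<phi>: "\<phi> \<in> borel_measurable borel"
    and Y: "Y \<in> borel_measurable M" and YW: "AE \<omega> in M. Y \<omega> = \<phi> (X \<omega>) + W \<omega>"
  shows "cond_distribution M Y X (\<lambda>x. distr \<nu> borel (\<lambda>y. \<phi> x + y))"
  unfolding cond_distribution_def
proof (intro conjI ballI X Y)
  interpret prob_space M by fact
  note F = subalgebra_vimage_algebra[OF X]
  have "prob_space \<nu>"
    using prob_space_distr[of W borel] W indep_law_distr[OF M F W \<nu>] by (simp add: indep_law_def)
  then show "(\<lambda>x. distr \<nu> borel (\<lambda>y. \<phi> x + y)) \<in> borel \<rightarrow>\<^sub>M prob_algebra borel"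
    using \<nu> \<phi> by (rule measurable_translation_kernel)
  show "AE \<omega> in M. real_cond_exp M (vimage_algebra (space M) X borel) (\<lambda>\<omega>'. indicator A (Y \<omega>')) \<omega> =
      measure (distr \<nu> borel (\<lambda>y. \<phi> (X \<omega>) + y)) A" if "A \<in> sets borel" for A
    using that
    by (intro real_cond_exp_indep_add[OF M F W \<nu> _ \<phi> Y YW] measurable_vimage_algebra1) auto
qed

text \<open>Independence from the whole past passes to the smaller algebra of \<open>X s\<close>.
  Both conditional expectations are therefore given by the same function of
  \<open>X s\<close>.\<close>

lemma markov_processI:
  fixes X :: "real \<Rightarrow> 'w \<Rightarrow> 'a::euclidean_space"
  assumes M: "prob_space M" and X: "\<And>t. 0 \<le> t \<Longrightarrow> X t \<in> borel_measurable M"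
    and increment: "\<And>s t. 0 \<le> s \<Longrightarrow> s \<le> t \<Longrightarrow> \<exists>W \<nu> \<phi>. indep_law M (gen_by M {0..s} borel X) W \<nu> \<and>
      sets \<nu> = sets borel \<and> \<phi> \<in> borel_measurable borel \<and> (\<forall>\<omega>\<in>space M. X t \<omega> = \<phi> (X s \<omega>) + W \<omega>)"
  shows "markov_process M X"
  unfolding markov_process_def
proof (intro conjI allI ballI impI X)
  fix s t :: real and A :: "'a set" assume A: "A \<in> sets borel" and "0 \<le> s \<and> s \<le> t"
  then have st: "0 \<le> s" "s \<le> t" "0 \<le> t" by auto
  let ?F = "gen_by M {0..s} borel X" and ?G = "vimage_algebra (space M) (X s) borel"
  obtain W \<nu> \<phi> where W: "indep_law M ?F W \<nu>" and \<nu>: "sets \<nu> = sets borel"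
    and \<phi>: "\<phi> \<in> borel_measurable borel" and eq: "\<And>\<omega>. \<omega> \<in> space M \<Longrightarrow> X t \<omega> = \<phi> (X s \<omega>) + W \<omega>"
    using increment[OF st(1,2)] by blast
  have F: "subalgebra M ?F"
    using X by (intro subalgebra_gen_by) auto
  have Xs: "X s \<in> borel_measurable ?F"
    using st by (intro measurable_gen_by) auto
  have G: "subalgebra M ?G"
    by (intro subalgebra_vimage_algebra X st)
  have "sets ?G \<subseteq> sets ?F"
    by (rule sets_image_in_sets[OF _ Xs]) simp
  with W have W': "indep_law M ?G W \<nu>"
    by (rule indep_law_mono)
  have "X s \<in> borel_measurable ?G"
    by (rule measurable_vimage_algebra1) simp
  from real_cond_exp_indep_add[OF M F W \<nu> Xs \<phi> X[OF st(3)] _ A]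
    real_cond_exp_indep_add[OF M G W' \<nu> this \<phi> X[OF st(3)] _ A]
  show "AE \<omega> in M. real_cond_exp M ?F (\<lambda>\<omega>'. indicator A (X t \<omega>')) \<omega> =
      real_cond_exp M ?G (\<lambda>\<omega>'. indicator A (X t \<omega>')) \<omega>"
    using eq by (auto elim!: eventually_elim2)
qed

section \<open>The Ornstein-Uhlenbeck process driven by Brownian motion\<close>

lemma measurable_ou_path:
  fixes B :: "real \<Rightarrow> 'w \<Rightarrow> 'a::euclidean_space"
  assumes "\<And>u. 0 \<le> u \<Longrightarrow> u \<le> t \<Longrightarrow> B u \<in> borel_measurable F" "0 \<le> t"
  shows "(\<lambda>\<omega>. ou_path m v \<xi> (\<lambda>u. B u \<omega>) t) \<in> borel_measurable F"
  unfolding ou_path_def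
  by (intro borel_measurable_add borel_measurable_const borel_measurable_scaleR measurable_exp_wiener_integral assms)

lemma borel_measurable_ou_mean [measurable]:
  fixes f :: "'b \<Rightarrow> 'a::euclidean_space"
  assumes [measurable]: "f \<in> borel_measurable M"
  shows "(\<lambda>x. ou_mean m v r (f x)) \<in> borel_measurable M"
  unfolding ou_mean_def by measurable

lemma ou_noise_indep_law:
  fixes B :: "real \<Rightarrow> 'w \<Rightarrow> 'a::euclidean_space"
  assumes B: "std_brownian_motion M B" and "m > 0" "0 \<le> s" "s < t"
  shows "indep_law M (gen_by M {0..s} borel B)
    (\<lambda>\<omega>. (sqrt 2 * exp (- (m * t))) *\<^sub>R
      (exp_wiener_integral m (\<lambda>u. B u \<omega>) t - exp_wiener_integral m (\<lambda>u. B u \<omega>) s))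
    (iso_gauss (ou_var m (t - s)))"
proof -
  \<comment> \<open>Scaling by \<open>c\<close> multiplies the variance by its square; the
    exponentials then combine to a function of \<open>t - s\<close> alone.\<close>
  have "(sqrt 2 * exp (- (m * t)))\<^sup>2 * ((exp (2 * m * t) - exp (2 * m * s)) / (2 * m)) =
      (exp (- (2 * m * t)) * exp (2 * m * t) - exp (- (2 * m * t)) * exp (2 * m * s)) / m"
    using \<open>m > 0\<close> by (simp add: power_mult_distrib exp_double[symmetric] field_simps)
  also have "\<dots> = ou_var m (t - s)"
    unfolding exp_add[symmetric] ou_var_def by (simp add: algebra_simps)
  finally show ?thesis
    using indep_law_scale[OF exp_wiener_integral_indep_law[OF assms], of "sqrt 2 * exp (- (m * t))"]
    by simp
qed

lemma std_brownian_motionD: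
  assumes "std_brownian_motion M B"
  shows "prob_space M" "\<And>t. 0 \<le> t \<Longrightarrow> B t \<in> borel_measurable M"
    "AE \<omega> in M. B 0 \<omega> = 0 \<and> continuous_on {0..} (\<lambda>t. B t \<omega>)"
    "\<And>s t. 0 \<le> s \<Longrightarrow> s < t \<Longrightarrow>
      indep_algebras M (gen_by M {0..s} borel B) (vimage_algebra (space M) (\<lambda>\<omega>. B t \<omega> - B s \<omega>) borel)"
  using assms by (auto simp: std_brownian_motion_def)

lemma indep_algebras_mono:
  assumes "prob_space M" "indep_algebras M F G" "sets F' \<subseteq> sets F" "sets G' \<subseteq> sets G"
  shows "indep_algebras M F' G'"
proof -
  interpret prob_space M by fact
  have FG: "indep_set (sets F) (sets G)"
    using assms by (simp add: indep_algebras_def)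
  show ?thesis
    unfolding indep_algebras_def
  proof (rule indep_setI)
    show "sets F' \<subseteq> events" "sets G' \<subseteq> events"
      using indep_setD_ev1[OF FG] indep_setD_ev2[OF FG] assms(3,4) by (metis order_trans)+
    show "prob (a \<inter> b) = prob a * prob b" if "a \<in> sets F'" "b \<in> sets G'" for a b
      using assms(3,4) that by (intro indep_setD[OF FG]) auto
  qed
qed

text \<open>Nonanticipation costs nothing: the start is deterministic and the path is a functional
  of the driving motion up to the present, so the pair generates no more than \<open>B\<close>
  alone.\<close>

lemma ou_path_sde_solution:
  fixes B :: "real \<Rightarrow> 'w \<Rightarrow> 'a::euclidean_space"
  assumes B: "std_brownian_motion M B" and m: "m > 0"
  shows "sde_solution M B (\<lambda>x. - (m *\<^sub>R x + v)) (sqrt 2) (\<lambda>_. \<xi>) (\<lambda>t \<omega>. ou_path m v \<xi> (\<lambda>u. B u \<omega>) t)"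
  unfolding sde_solution_def
proof (intro conjI allI impI B)
  show "(\<lambda>\<omega>. ou_path m v \<xi> (\<lambda>u. B u \<omega>) t) \<in> borel_measurable M" if "t \<ge> 0" for t
    using that std_brownian_motionD(2)[OF B] by (intro measurable_ou_path) auto
  show "indep_algebras M (gen_by M {0..s} (borel \<Otimes>\<^sub>M borel) (\<lambda>u \<omega>. (ou_path m v \<xi> (\<lambda>u. B u \<omega>) u, B u \<omega>)))
      (vimage_algebra (space M) (\<lambda>\<omega>. B t \<omega> - B s \<omega>) borel)" if "0 \<le> s \<and> s < t" for s t
  proof (rule indep_algebras_mono[OF std_brownian_motionD(1)[OF B] std_brownian_motionD(4)[OF B]])
    show "sets (gen_by M {0..s} (borel \<Otimes>\<^sub>M borel) (\<lambda>u \<omega>. (ou_path m v \<xi> (\<lambda>u. B u \<omega>) u, B u \<omega>))) \<subseteq>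
        sets (gen_by M {0..s} borel B)"
      by (intro sets_gen_by_subset measurable_Pair measurable_ou_path measurable_gen_by) auto
  qed (use that in auto)
  show "AE \<omega> in M. ou_path m v \<xi> (\<lambda>u. B u \<omega>) 0 = \<xi> \<and>
      continuous_on {0..} (ou_path m v \<xi> (\<lambda>u. B u \<omega>)) \<and>
      (\<forall>t\<ge>0. set_integrable lborel {0..t} (\<lambda>s. - (m *\<^sub>R ou_path m v \<xi> (\<lambda>u. B u \<omega>) s + v)) \<and>
        ou_path m v \<xi> (\<lambda>u. B u \<omega>) t =
        \<xi> + (LINT s:{0..t}|lborel. - (m *\<^sub>R ou_path m v \<xi> (\<lambda>u. B u \<omega>) s + v)) + sqrt 2 *\<^sub>R B t \<omega>)"
    using std_brownian_motionD(3)[OF B]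
  proof eventually_elim
    case (elim \<omega>)
    then have cont: "continuous_on {0..} (ou_path m v \<xi> (\<lambda>u. B u \<omega>))"
      using m by (intro ou_path_continuous_on) auto
    show ?case
      using elim m cont ou_path_solves[of "\<lambda>u. B u \<omega>" m _ v \<xi>] set_integrable_affine_drift[OF cont, of _ m v]
      by auto
  qed
qed

text \<open>Pathwise uniqueness is applied with the initial value \<open>\<Xi> \<omega>\<close>, so
  the same result serves the random start of Stage 2 and the deterministic start of the conditioned
  equation.\<close>

lemma sde_solution_eq_ou_path:
  fixes B :: "real \<Rightarrow> 'w \<Rightarrow> 'a::euclidean_space"
  assumes U: "sde_solution M B (\<lambda>x. - (m *\<^sub>R x + v)) (sqrt 2) \<Xi> U" and m: "m > 0" and "t \<ge> 0"
  shows "AE \<omega> in M. U t \<omega> = ou_path m v (\<Xi> \<omega>) (\<lambda>u. B u \<omega>) t"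
proof -
  have "std_brownian_motion M B"
    and eq: "AE \<omega> in M. U 0 \<omega> = \<Xi> \<omega> \<and> continuous_on {0..} (\<lambda>t. U t \<omega>) \<and>
        (\<forall>t\<ge>0. set_integrable lborel {0..t} (\<lambda>s. - (m *\<^sub>R U s \<omega> + v)) \<and>
           U t \<omega> = \<Xi> \<omega> + (LINT s:{0..t}|lborel. - (m *\<^sub>R U s \<omega> + v)) + sqrt 2 *\<^sub>R B t \<omega>)"
    using U by (auto simp: sde_solution_def)
  from eq std_brownian_motionD(3)[OF this(1)] show ?thesis
  proof eventually_elim
    case (elim \<omega>)
    then show ?case
      using m \<open>t \<ge> 0\<close> by (intro ou_path_unique[where x="\<lambda>t. U t \<omega>" and \<beta>="\<lambda>u. B u \<omega>"]) auto
  qed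
qed

lemma sets_gen_by_ou_path_subset:
  assumes "0 \<le> s"
  shows "sets (gen_by M {0..s} borel (\<lambda>t \<omega>. ou_path m v \<xi> (\<lambda>u. B u \<omega>) t)) \<subseteq> sets (gen_by M {0..s} borel B)"
  using assms by (intro sets_gen_by_subset measurable_ou_path measurable_gen_by) auto

lemma ou_path_markov_process:
  fixes B :: "real \<Rightarrow> 'w \<Rightarrow> 'a::euclidean_space"
  assumes B: "std_brownian_motion M B" and m: "m > 0"
  shows "markov_process M (\<lambda>t \<omega>. ou_path m v \<xi> (\<lambda>u. B u \<omega>) t)"
proof (rule markov_processI)
  let ?X = "\<lambda>t \<omega>. ou_path m v \<xi> (\<lambda>u. B u \<omega>) t"
  show M: "prob_space M"
    by (rule std_brownian_motionD[OF B])
  show X: "?X t \<in> borel_measurable M" if "0 \<le> t" for t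
    using that std_brownian_motionD(2)[OF B] by (intro measurable_ou_path) auto
  fix s t :: real assume st: "0 \<le> s" "s \<le> t"
  show "\<exists>W \<nu> \<phi>. indep_law M (gen_by M {0..s} borel ?X) W \<nu> \<and> sets \<nu> = sets borel \<and>
      \<phi> \<in> borel_measurable borel \<and> (\<forall>\<omega>\<in>space M. ?X t \<omega> = \<phi> (?X s \<omega>) + W \<omega>)"
  proof (cases "s = t")
    case True
    have "indep_law M (gen_by M {0..s} borel ?X) (\<lambda>_. 0) (return borel 0)"
      using X by (intro indep_law_0 M subalgebra_gen_by) auto
    then show ?thesis
      using True by (intro exI[of _ "\<lambda>_. 0"] exI[of _ "return borel 0"] exI[of _ "\<lambda>x. x"]) auto
  next
    case False
    with st have "s < t" by simp
    let ?W = "\<lambda>\<omega>. (sqrt 2 * exp (- (m * t))) *\<^sub>R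
      (exp_wiener_integral m (\<lambda>u. B u \<omega>) t - exp_wiener_integral m (\<lambda>u. B u \<omega>) s)"
    show ?thesis
    proof (rule exI[of _ ?W], rule exI[of _ "iso_gauss (ou_var m (t - s))"],
        rule exI[of _ "ou_mean m v (t - s)"], intro conjI ballI)
      show "indep_law M (gen_by M {0..s} borel ?X) ?W (iso_gauss (ou_var m (t - s)))"
        by (rule indep_law_mono[OF ou_noise_indep_law[OF B m st(1) \<open>s < t\<close>] sets_gen_by_ou_path_subset[OF st(1)]])
      show "?X t \<omega> = ou_mean m v (t - s) (?X s \<omega>) + ?W \<omega>" for \<omega>
        by (rule ou_path_increment)
    qed simp_all
  qed
qed

definition ou_density :: "real \<Rightarrow> 'a::euclidean_space \<Rightarrow> 'a \<Rightarrow> real \<Rightarrow> 'a \<Rightarrow> real \<Rightarrow> real" where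
  "ou_density m v w t w' s = iso_normal_density (ou_mean m v (t - s) w') (sqrt (ou_var m (t - s))) w"

lemma density_ou_density:
  assumes "m > 0" "s < t"
  shows "density lborel (\<lambda>w. ennreal (ou_density m v w t w' s)) =
    distr (iso_gauss (ou_var m (t - s))) borel (\<lambda>y. ou_mean m v (t - s) w' + y)"
  using distr_affine_iso_gauss[of "ou_var m (t - s)" 1 "ou_mean m v (t - s) w'"] ou_var_pos[of m "t - s"] assms
  by (simp add: ou_density_def)

lemma ou_path_transition_density:
  fixes B :: "real \<Rightarrow> 'w \<Rightarrow> 'a::euclidean_space"
  assumes B: "std_brownian_motion M B" and m: "m > 0"
  shows "transition_density M (\<lambda>t \<omega>. ou_path m v \<xi> (\<lambda>u. B u \<omega>) t) (ou_density m v)"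
  unfolding transition_density_def
proof (intro allI impI conjI)
  let ?X = "\<lambda>t \<omega>. ou_path m v \<xi> (\<lambda>u. B u \<omega>) t"
  fix s t :: real assume "0 \<le> s \<and> s < t"
  then have st: "0 \<le> s" "s < t" "0 \<le> t" by auto
  show "(\<lambda>(w, w'). ou_density m v w t w' s) \<in> borel_measurable (borel \<Otimes>\<^sub>M borel)"
    unfolding ou_density_def by measurable
  show "0 \<le> ou_density m v w t w' s" for w w'
    by (simp add: ou_density_def)
  have X: "?X u \<in> borel_measurable M" if "0 \<le> u" for u
    using that std_brownian_motionD(2)[OF B] by (intro measurable_ou_path) auto
  have "?X s \<in> borel_measurable (gen_by M {0..s} borel B)"
    using st by (intro measurable_ou_path measurable_gen_by) auto
  then have "sets (vimage_algebra (space M) (?X s) borel) \<subseteq> sets (gen_by M {0..s} borel B)"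
    by (intro sets_image_in_sets) auto
  from indep_law_mono[OF ou_noise_indep_law[OF B m st(1,2)] this]
  show "cond_distribution M (?X t) (?X s) (\<lambda>w'. density lborel (\<lambda>w. ennreal (ou_density m v w t w' s)))"
    unfolding density_ou_density[OF m st(2)]
    by (rule cond_distribution_indep_add[OF std_brownian_motionD(1)[OF B] X[OF st(1)] _ _ _ X[OF st(3)]])
      (simp_all add: ou_path_increment[symmetric])
qed

lemma distr_ou_path:
  fixes B :: "real \<Rightarrow> 'w \<Rightarrow> 'a::euclidean_space"
  assumes B: "std_brownian_motion M B" and m: "m > 0" and t: "t > 0"
  shows "distr M borel (\<lambda>\<omega>. ou_path m v \<xi> (\<lambda>u. B u \<omega>) t) =
    distr (iso_gauss (ou_var m t)) borel (\<lambda>y. ou_mean m v t \<xi> + y)"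
proof -
  let ?W = "\<lambda>\<omega>. (sqrt 2 * exp (- (m * t))) *\<^sub>R (exp_wiener_integral m (\<lambda>u. B u \<omega>) t - exp_wiener_integral m (\<lambda>u. B u \<omega>) 0)"
  note M = std_brownian_motionD(1)[OF B]
  have W: "indep_law M (gen_by M {0..0} borel B) ?W (iso_gauss (ou_var m t))"
    using ou_noise_indep_law[OF B m order_refl t] by simp
  have "subalgebra M (gen_by M {0..0} borel B)"
    using std_brownian_motionD(2)[OF B] by (intro subalgebra_gen_by) auto
  from indep_law_distr[OF M this W]
  have "distr M borel ?W = iso_gauss (ou_var m t)" by simp
  then have "distr (iso_gauss (ou_var m t)) borel (\<lambda>y. ou_mean m v t \<xi> + y) =
      distr (distr M borel ?W) borel (\<lambda>y. ou_mean m v t \<xi> + y)"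
    by simp
  also have "\<dots> = distr M borel (\<lambda>\<omega>. ou_path m v \<xi> (\<lambda>u. B u \<omega>) t)"
    using W by (subst distr_distr) (auto simp: indep_law_def comp_def ou_path_def)
  finally show ?thesis ..
qed

section \<open>The quadratic prior and the algorithm\<close>

text \<open>Since \<open>grad\<close> is a definite description, uniqueness of the derivative has to
  be established as well.\<close>

lemma grad_quadratic: "grad (\<lambda>w. m / 2 * (norm w)\<^sup>2) x = m *\<^sub>R (x :: 'a::euclidean_space)"
  unfolding grad_def
proof (rule the_equality)
  have D: "((\<lambda>w::'a. m / 2 * (norm w)\<^sup>2) has_derivative (\<lambda>h. h \<bullet> (m *\<^sub>R x))) (at x)"
    unfolding power2_norm_eq_inner by (auto intro!: derivative_eq_intros simp: inner_commute)
  then show "GDERIV (\<lambda>w. m / 2 * (norm w)\<^sup>2) x :> m *\<^sub>R x"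
    by (simp add: gderiv_def)
  fix y assume "GDERIV (\<lambda>w. m / 2 * (norm w)\<^sup>2) x :> y"
  then have "(\<lambda>h. h \<bullet> y) = (\<lambda>h. h \<bullet> (m *\<^sub>R x))"
    using has_derivative_unique[OF _ D] by (simp add: gderiv_def)
  then show "y = m *\<^sub>R x"
    by (metis inner_commute vector_eq_ldot)
qed

text \<open>A differentiable gradient is continuous. This makes the Stage 1 map Borel, as a
  conditional kernel requires.\<close>

lemma twice_differentiable_borel_measurable_grad:
  assumes "twice_differentiable f"
  shows "grad f \<in> borel_measurable borel"
  using assms
  by (intro borel_measurable_continuous_onI continuous_at_imp_continuous_on)
    (simp add: twice_differentiable_def differentiable_imp_continuous_within)

text \<open>With \<open>j = k - 1\<close> this places the conditioning variable in the past from
  which the noise of Stage 2 is independent.\<close>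

lemma lapd_past_measurable_iterate:
  assumes "j < k"
  shows "wt j \<in> borel_measurable (lapd_past M wt V B k)"
proof -
  let ?P = "PiM {..<k} (\<lambda>_. borel) \<Otimes>\<^sub>M PiM ({1..<k} \<times> {0..}) (\<lambda>_. borel \<Otimes>\<^sub>M borel)"
  let ?f = "\<lambda>\<omega>. (\<lambda>j\<in>{..<k}. wt j \<omega>, \<lambda>(j, t)\<in>{1..<k} \<times> {0..}. (V j t \<omega>, B j t \<omega>))"
  have "?f \<in> lapd_past M wt V B k \<rightarrow>\<^sub>M ?P"
    unfolding lapd_past_def
    by (intro measurable_vimage_algebra1) (auto simp: space_pair_measure space_PiM)
  then have "(\<lambda>\<omega>. fst (?f \<omega>) j) \<in> borel_measurable (lapd_past M wt V B k)"
    using assms by (intro measurable_compose[OF measurable_compose[OF _ measurable_fst]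
        measurable_component_singleton[of j "{..<k}" "\<lambda>_. borel"]]) auto
  then show ?thesis using assms by simp
qed

theorem lemma4p3:
  fixes M :: "'w measure"
    and f g p0 :: "'a::euclidean_space \<Rightarrow> real"
    and \<eta>t \<eta> :: "nat \<Rightarrow> real"
    and wt ws :: "nat \<Rightarrow> 'w \<Rightarrow> 'a"
    and V B :: "nat \<Rightarrow> real \<Rightarrow> 'w \<Rightarrow> 'a"
    and m :: real and k :: nat
  assumes "twice_differentiable f"
    and "m > 0"
    and "\<And>w. g w = m / 2 * (norm w)\<^sup>2"
    and "k \<ge> 1"
    and "lapd M f g p0 \<eta>t \<eta> wt ws V B"
  shows "\<exists>(wh :: 'a \<Rightarrow> real \<Rightarrow> 'w \<Rightarrow> 'a) (p :: 'a \<Rightarrow> 'a \<Rightarrow> real \<Rightarrow> 'a \<Rightarrow> real \<Rightarrow> real).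
    (\<forall>w0.
       sde_solution M (B k)
         (\<lambda>x. - (m *\<^sub>R x + (m * \<eta>t (k - 1) / (exp (m * \<eta> k) - 1)) *\<^sub>R grad f w0))
         (sqrt 2) (\<lambda>_. w0) (wh w0) \<and>
       markov_process M (wh w0) \<and>
       transition_density M (wh w0) (p w0) \<and>
       distributed M lborel (wh w0 (\<eta> k)) (\<lambda>w. ennreal (p w0 w (\<eta> k) w0 0)) \<and>
       (\<forall>U. sde_solution M (B k) (\<lambda>x. - grad g x) (sqrt 2)
              (\<lambda>_. w0 - \<eta>t (k - 1) *\<^sub>R grad f w0) U \<longrightarrow>
            distr M borel (wh w0 (\<eta> k)) = distr M borel (U (\<eta> k))) \<and>
       (\<forall>w. p w0 w (\<eta> k) w0 0 =
          (2 * pi * (1 - exp (- (2 * m * \<eta> k))) / m) powr (- real DIM('a) / 2) *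
          exp (- (m / 2) *
            ((norm (w - exp (- (m * \<eta> k)) *\<^sub>R (w0 - \<eta>t (k - 1) *\<^sub>R grad f w0)))\<^sup>2 /
             (1 - exp (- (2 * m * \<eta> k))))))) \<and>
    cond_distribution M (wt k) (wt (k - 1)) (\<lambda>w0. distr M borel (wh w0 (\<eta> k)))"
proof -
  \<comment> \<open>The vector \<open>v\<close> solves \<open>exp (- m \<eta>) (w0 + v / m) - v / m
    = exp (- m \<eta>) (w0 - \<eta>t grad f w0)\<close>, that is,
    \<open>(exp (m \<eta>) - 1) v / m = \<eta>t grad f w0\<close>, with \<open>\<eta>\<close> and
    \<open>\<eta>t\<close> standing for the two step sizes.\<close>
  define v where "v w0 = (m * \<eta>t (k - 1) / (exp (m * \<eta> k) - 1)) *\<^sub>R grad f w0" for w0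
  define wh where "wh w0 t \<omega> = ou_path m (v w0) w0 (\<lambda>u. B k u \<omega>) t" for w0 t \<omega>
  define \<phi> where "\<phi> w0 = exp (- (m * \<eta> k)) *\<^sub>R (w0 - \<eta>t (k - 1) *\<^sub>R grad f w0)" for w0
  let ?p = "\<lambda>w0. ou_density m (v w0)"
  note m = \<open>m > 0\<close>
  have \<eta>: "\<eta> k > 0"
    and ws: "\<And>\<omega>. \<omega> \<in> space M \<Longrightarrow> ws k \<omega> = wt (k - 1) \<omega> - \<eta>t (k - 1) *\<^sub>R grad f (wt (k - 1) \<omega>)"
    and V: "sde_solution M (B k) (\<lambda>x. - grad g x) (sqrt 2) (ws k) (V k)"
    and past: "indep_algebras M (lapd_past M wt V B k) (gen_by M {0..} borel (B k))"
    and wt: "\<And>\<omega>. \<omega> \<in> space M \<Longrightarrow> wt k \<omega> = V k (\<eta> k) \<omega>"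
    using assms(4,5) unfolding lapd_def by auto
  from V have B: "std_brownian_motion M (B k)" by (simp add: sde_solution_def)
  note M = std_brownian_motionD(1)[OF B]
  have "g = (\<lambda>w. m / 2 * (norm w)\<^sup>2)"
    using assms(3) by blast
  \<comment> \<open>Stage 2 becomes the case \<open>v = 0\<close> of the affine drift, so the same
    explicit solution covers both equations.\<close>
  then have drift: "(\<lambda>x. - grad g x) = (\<lambda>x. - (m *\<^sub>R x + 0))"
    by (simp only: grad_quadratic add_0_right)
  have wt_meas: "wt j \<in> borel_measurable M" for j
  proof (cases "j = 0")
    case True
    then show ?thesis
      using assms(5) by (auto simp: lapd_def distributed_def)
  next
    case False
    then have "V j (\<eta> j) \<in> borel_measurable M" "\<And>\<omega>. \<omega> \<in> space M \<Longrightarrow> wt j \<omega> = V j (\<eta> j) \<omega>"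
      using assms(5) by (auto simp: lapd_def sde_solution_def less_imp_le)
    then show ?thesis
      by (simp cong: measurable_cong)
  qed
  have mean: "ou_mean m (v w0) (\<eta> k) w0 = \<phi> w0" for w0
  proof -
    let ?e = "exp (m * \<eta> k)"
    have e: "?e - 1 \<noteq> 0" using m \<eta> by auto
    \<comment> \<open>This is the coefficient of the gradient in \<open>v / m\<close>; the relation
      \<open>(exp (m * \<eta> k) - 1) * q = \<eta>t (k - 1)\<close> is what makes the two means
      agree.\<close>
    define q where "q = \<eta>t (k - 1) / (?e - 1)"
    have "(1 / m) *\<^sub>R v w0 = q *\<^sub>R grad f w0"
      using m by (simp add: v_def q_def)
    then have "ou_mean m (v w0) (\<eta> k) w0 =
        exp (- (m * \<eta> k)) *\<^sub>R w0 + (exp (- (m * \<eta> k)) * q - q) *\<^sub>R grad f w0"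
      by (simp add: ou_mean_def scaleR_add_right scaleR_diff_left)
    also have "exp (- (m * \<eta> k)) * q - q = - (exp (- (m * \<eta> k)) * \<eta>t (k - 1))"
    proof -
      have "(?e - 1) * q = \<eta>t (k - 1)" and "exp (- (m * \<eta> k)) * ?e = 1"
        using e by (simp_all add: q_def exp_add[symmetric])
      moreover have "exp (- (m * \<eta> k)) * q - q =
          - (exp (- (m * \<eta> k)) * ((?e - 1) * q)) + (exp (- (m * \<eta> k)) * ?e - 1) * q"
        by (simp only: algebra_simps)
      ultimately show ?thesis by simp
    qed
    finally show ?thesis
      by (simp add: \<phi>_def scaleR_diff_right)
  qed
  have mean0: "ou_mean m 0 (\<eta> k) (w0 - \<eta>t (k - 1) *\<^sub>R grad f w0) = \<phi> w0" for w0
    by (simp add: ou_mean_def \<phi>_def)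
  have law: "distr M borel (wh w0 (\<eta> k)) = distr (iso_gauss (ou_var m (\<eta> k))) borel (\<lambda>y. \<phi> w0 + y)" for w0
    unfolding wh_def using distr_ou_path[OF B m \<eta>, of "v w0" w0] by (simp add: mean)
  have wh_meas: "wh w0 (\<eta> k) \<in> borel_measurable M" for w0
    unfolding wh_def using \<eta> std_brownian_motionD(2)[OF B] by (intro measurable_ou_path) auto
  have "sde_solution M (B k) (\<lambda>x. - (m *\<^sub>R x + v w0)) (sqrt 2) (\<lambda>_. w0) (wh w0)" for w0
    using ou_path_sde_solution[OF B m, of "v w0" w0] by (simp add: wh_def[abs_def])
  moreover have "markov_process M (wh w0)" for w0
    using ou_path_markov_process[OF B m] by (simp add: wh_def[abs_def])
  moreover have "transition_density M (wh w0) (?p w0)" for w0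
    using ou_path_transition_density[OF B m] by (simp add: wh_def[abs_def])
  moreover have "distributed M lborel (wh w0 (\<eta> k)) (\<lambda>w. ennreal (?p w0 w (\<eta> k) w0 0))" for w0
  proof -
    have "distr M lborel (wh w0 (\<eta> k)) = distr M borel (wh w0 (\<eta> k))"
      by (rule distr_cong) auto
    then show ?thesis
      using wh_meas density_ou_density[OF m \<eta>, of "v w0" w0]
      by (simp add: distributed_def law mean ou_density_def)
  qed
  moreover have "distr M borel (wh w0 (\<eta> k)) = distr M borel (U (\<eta> k))"
    if U: "sde_solution M (B k) (\<lambda>x. - grad g x) (sqrt 2) (\<lambda>_. w0 - \<eta>t (k - 1) *\<^sub>R grad f w0) U" for w0 U
  proof -
    \<comment> \<open>Both variables are \<open>\<phi> w0\<close> plus the same Wiener term, since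
      the processes share the driving motion.\<close>
    have "AE \<omega> in M. U (\<eta> k) \<omega> = wh w0 (\<eta> k) \<omega>"
      using sde_solution_eq_ou_path[OF U[unfolded drift] m less_imp_le[OF \<eta>]]
      by eventually_elim (simp add: wh_def ou_path_def mean mean0 del: One_nat_def)
    moreover have "U (\<eta> k) \<in> borel_measurable M"
      using U \<eta> by (simp add: sde_solution_def)
    ultimately show ?thesis
      using wh_meas by (intro distr_cong_AE) (auto elim: eventually_mono)
  qed
  moreover have "?p w0 w (\<eta> k) w0 0 =
      (2 * pi * (1 - exp (- (2 * m * \<eta> k))) / m) powr (- real DIM('a) / 2) *
      exp (- (m / 2) * ((norm (w - \<phi> w0))\<^sup>2 / (1 - exp (- (2 * m * \<eta> k)))))" for w0 w
  proof -
    have sq: "(sqrt (ou_var m (\<eta> k)))\<^sup>2 = ou_var m (\<eta> k)" and pos: "sqrt (ou_var m (\<eta> k)) > 0"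
      using ou_var_pos[OF m \<eta>] by simp_all
    have "2 * pi * ou_var m (\<eta> k) = 2 * pi * (1 - exp (- (2 * m * \<eta> k))) / m"
      and "- N / (2 * ou_var m (\<eta> k)) = - (m / 2) * (N / (1 - exp (- (2 * m * \<eta> k))))" for N
      by (simp_all add: ou_var_def)
    then show ?thesis
      by (simp only: ou_density_def diff_0_right mean iso_normal_density_eq[OF pos] sq)
  qed
  moreover have "cond_distribution M (wt k) (wt (k - 1)) (\<lambda>w0. distr M borel (wh w0 (\<eta> k)))"
  proof -
    let ?W = "\<lambda>\<omega>. (sqrt 2 * exp (- (m * \<eta> k))) *\<^sub>R exp_wiener_integral m (\<lambda>u. B k u \<omega>) (\<eta> k)"
    \<comment> \<open>The independence of the past is stated for the algebra generated by
      \<open>B k\<close>, so the noise must be measurable there and not merely equal almost surely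
      to such a variable.\<close>
    have W_B: "?W \<in> borel_measurable (gen_by M {0..} borel (B k))"
      using \<eta> by (intro borel_measurable_scaleR borel_measurable_const measurable_exp_wiener_integral measurable_gen_by) auto
    \<comment> \<open>The trivial past at time 0 serves only to identify the law of the noise; its
      independence from \<open>wt (k - 1)\<close> comes from \<open>past\<close>.\<close>
    have W0: "indep_law M (gen_by M {0..0} borel (B k)) ?W (iso_gauss (ou_var m (\<eta> k)))"
      using ou_noise_indep_law[OF B m order_refl \<eta>] by simp
    then have W_M: "?W \<in> borel_measurable M"
      by (simp add: indep_law_def)
    have "subalgebra M (gen_by M {0..0} borel (B k))"
      using std_brownian_motionD(2)[OF B] by (intro subalgebra_gen_by) auto
    from indep_law_distr[OF M this W0] have W_law: "distr M borel ?W = iso_gauss (ou_var m (\<eta> k))"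
      by simp
    have "k - 1 < k" using assms(4) by simp
    then have "sets (vimage_algebra (space M) (wt (k - 1)) borel) \<subseteq> sets (lapd_past M wt V B k)"
      by (intro sets_image_in_sets lapd_past_measurable_iterate) (simp_all add: lapd_past_def)
    moreover have "sets (vimage_algebra (space M) ?W borel) \<subseteq> sets (gen_by M {0..} borel (B k))"
      by (intro sets_image_in_sets W_B) simp
    ultimately have "indep_algebras M (vimage_algebra (space M) (wt (k - 1)) borel) (vimage_algebra (space M) ?W borel)"
      by (rule indep_algebras_mono[OF M past])
    from indep_algebras_imp_indep_law[OF M W_M this]
    have W: "indep_law M (vimage_algebra (space M) (wt (k - 1)) borel) ?W (iso_gauss (ou_var m (\<eta> k)))"
      by (simp add: W_law)
    show ?thesis
      unfolding law
    proof (rule cond_distribution_indep_add[OF M wt_meas W _ _ wt_meas])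
      show "\<phi> \<in> borel_measurable borel"
        using twice_differentiable_borel_measurable_grad[OF assms(1)] unfolding \<phi>_def[abs_def] by measurable
      \<comment> \<open>Here the start \<open>ws k\<close> is random. Pathwise uniqueness turns
        Stage 2 into the measurable map \<open>\<phi>\<close> of the previous iterate plus
        independent noise, which is the kernel given by \<open>law\<close>.\<close>
      show "AE \<omega> in M. wt k \<omega> = \<phi> (wt (k - 1) \<omega>) + ?W \<omega>"
        using sde_solution_eq_ou_path[OF V[unfolded drift] m less_imp_le[OF \<eta>]] AE_space
        by eventually_elim (simp add: wt ws ou_path_def mean0 del: One_nat_def)
    qed simp
  qed
  ultimately show ?thesis
    unfolding v_def \<phi>_def by (intro exI[of _ wh] exI[of _ ?p] conjI allI impI) (simp_all add: v_def)
qed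

end
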